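(* Let $D_1,\dots,D_n$ be commuting $d\times d$ matrices with coefficients in $\mathbb{Z}$, and assume that every $D_i$ is expanding. For $i=1,\dots,n$ let $\alpha_i\in\mathbb{R}^d$ and let $$h_i:\mathbb{T}^d\to\mathbb{T}^d,\qquad h_i(x)=D_i(x)+\alpha_i .$$ Assume that (the image in $\mathbb{T}^d$ of) the set $$\left\{(\mathbb{I}_d-D_i)\alpha_j-(\mathbb{I}_d-D_j)\alpha_i:\ i,j\in\{1,\dots,n\}\right\}$$ is not contained in any proper closed subgroup of $\mathbb{T}^d$. Let $\mu$ be a probability measure such that $\operatorname{supp}\mu=\{h_1,\dots,h_n\}$. Then Haar measure is the unique $\mu$-stationary measure on $\mathbb{T}^d$.
   Context: $\mathbb{T}^d=\mathbb{R}^d/\mathbb{Z}^d$, and Haar measure means the Haar probability measure. A matrix is called expanding if all of its complex eigenvalues have modulus greater than $1$. An integer matrix $D$ also denotes the toral endomorphism $x\mapsto Dx \pmod{\mathbb{Z}^d}$; vectors in $\mathbb{R}^d$ are regarded as elements of $\mathbb{T}^d$ via reduction mod $\mathbb{Z}^d$, and addition is that of $\mathbb{T}^d$. $\mathbb{I}_d$ is the $d\times d$ identity matrix. For a probability measure $\mu$ on the set of maps $\{h_1,\dots,h_n\}$ and a Borel probability measure $\nu$ on $\mathbb{T}^d$, the convolution is $\mu*\nu(A)=\int g_*\nu(A)\,d\mu(g)$; a probability measure $\nu$ is $\mu$-stationary if $\mu*\nu=\nu$. The condition $\operatorname{supp}\mu=\{h_1,\dots,h_n\}$ means $\mu$ is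 concentrated on $\{h_1,\dots,h_n\}$ and $\mu(\{h_i\})>0$ for every $i$. *)

theory Defs
  imports "HOL-Probability.Probability"
begin

definition int_vec :: "real^'d \<Rightarrow> bool" where
  "int_vec x \<longleftrightarrow> (\<forall>i. x $ i \<in> \<int>)"

lemma int_vec_0 [simp]: "int_vec 0"
  by (simp add: int_vec_def)

lemma int_vec_add: "int_vec x \<Longrightarrow> int_vec y \<Longrightarrow> int_vec (x + y)"
  by (simp add: int_vec_def)

lemma int_vec_diff: "int_vec x \<Longrightarrow> int_vec y \<Longrightarrow> int_vec (x - y)"
  by (simp add: int_vec_def)

lemma int_vec_uminus: "int_vec x \<Longrightarrow> int_vec (- x)"
  by (simp add: int_vec_def)

lemma int_vec_matrix_mult:
  fixes D :: "int^'d^'d"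
  assumes "int_vec x"
  shows "int_vec (map_matrix of_int D *v x)"
  using assms unfolding int_vec_def
  by (auto simp: matrix_vector_mult_def intro!: Ints_sum Ints_mult)

definition torus_rel :: "real^'d \<Rightarrow> real^'d \<Rightarrow> bool" where
  "torus_rel x y \<longleftrightarrow> int_vec (x - y)"

lemma equivp_torus_rel: "equivp torus_rel"
proof (rule equivpI)
  show "reflp torus_rel"
    by (simp add: reflp_def torus_rel_def)
  show "symp torus_rel"
    unfolding symp_def torus_rel_def by (metis int_vec_uminus minus_diff_eq)
  show "transp torus_rel"
    unfolding transp_def torus_rel_def
    by (metis int_vec_add add_diff_eq diff_add_cancel)
qed

quotient_type 'd torus = "real^'d" / torus_rel
  by (rule equivp_torus_rel)

lift_definition to_torus :: "real^'d \<Rightarrow> 'd torus" is "\<lambda>x. x" .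

lemma to_torus_eq_iff: "to_torus x = to_torus y \<longleftrightarrow> int_vec (x - y)"
  by transfer (simp add: torus_rel_def)

lemma to_torus_cases: obtains x where "t = to_torus x"
  by transfer (metis torus_rel_def diff_self int_vec_0)

lemma surj_to_torus: "surj to_torus"
  by (metis surjI to_torus_cases)

instantiation torus :: (finite) ab_group_add
begin

lift_definition zero_torus :: "'a torus" is "0" .

lift_definition plus_torus :: "'a torus \<Rightarrow> 'a torus \<Rightarrow> 'a torus" is "(+)"
  unfolding torus_rel_def by (metis add_diff_add int_vec_add)

lift_definition minus_torus :: "'a torus \<Rightarrow> 'a torus \<Rightarrow> 'a torus" is "(-)"
  unfolding torus_rel_def by (metis diff_diff_add diff_add_eq_diff_diff_swap add_diff_eq
      diff_diff_eq2 add.commute diff_add_eq int_vec_diff)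

lift_definition uminus_torus :: "'a torus \<Rightarrow> 'a torus" is "uminus"
  unfolding torus_rel_def by (metis int_vec_uminus minus_diff_minus)

instance
  by standard (transfer; simp add: torus_rel_def algebra_simps)+

end

lemma to_torus_0: "to_torus 0 = 0"
  by transfer (simp add: torus_rel_def)

lemma to_torus_add: "to_torus (x + y) = to_torus x + to_torus y"
  by transfer (simp add: torus_rel_def)

lemma to_torus_diff: "to_torus (x - y) = to_torus x - to_torus y"
  by transfer (simp add: torus_rel_def)

lemma to_torus_uminus: "to_torus (- x) = - to_torus x"
  by transfer (simp add: torus_rel_def)

instantiation torus :: (finite) topological_space
begin

definition open_torus :: "'a torus set \<Rightarrow> bool" where
  "open_torus U \<longleftrightarrow> open (to_torus -` U)"

instance
proof
  show "open (UNIV :: 'a torus set)"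
    by (simp add: open_torus_def)
  show "open (S \<inter> T)" if "open S" "open T" for S T :: "'a torus set"
    using that by (auto simp: open_torus_def)
  show "open (\<Union>K)" if "\<forall>S\<in>K. open S" for K :: "'a torus set set"
    using that by (auto simp: open_torus_def vimage_Union)
qed

end

lemma continuous_on_to_torus: "continuous_on UNIV to_torus"
  by (auto simp: continuous_on_open_vimage open_torus_def)

lemma open_to_torus_image:
  assumes "open U"
  shows "open (to_torus ` U)"
proof -
  have "to_torus -` (to_torus ` U) = (\<Union>k\<in>Collect int_vec. (+) k ` U)"
  proof (intro set_eqI iffI)
    fix x assume "x \<in> to_torus -` (to_torus ` U)"
    then obtain u where u: "u \<in> U" "int_vec (x - u)"
      by (auto simp: to_torus_eq_iff)
    then show "x \<in> (\<Union>k\<in>Collect int_vec. (+) k ` U)"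
      by (auto intro!: bexI[of _ "x - u"] image_eqI[of _ _ u])
  next
    fix x assume "x \<in> (\<Union>k\<in>Collect int_vec. (+) k ` U)"
    then obtain k u where "int_vec k" "u \<in> U" "x = k + u"
      by auto
    then have "to_torus x = to_torus u" "u \<in> U"
      by (auto simp: to_torus_eq_iff)
    then show "x \<in> to_torus -` (to_torus ` U)"
      by auto
  qed
  then show ?thesis
    using assms by (auto simp: open_torus_def open_translation)
qed

instance torus :: (finite) second_countable_topology
proof
  obtain B :: "(real^'a) set set" where B: "countable B" "topological_basis B"
    using ex_countable_basis by blast
  have "topological_basis ((`) to_torus ` B)"
    unfolding topological_basis_def
  proof (intro conjI ballI allI impI)
    fix V assume "V \<in> (`) to_torus ` B"
    then show "open V"
      using B(2) by (auto intro!: open_to_torus_image topological_basis_open)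
  next
    fix U :: "'a torus set" assume "open U"
    then have "open (to_torus -` U)"
      by (simp add: open_torus_def)
    then obtain C where C: "C \<subseteq> B" "\<Union>C = to_torus -` U"
      using B(2) by (auto simp: topological_basis_def)
    then have "(\<Union>c\<in>C. to_torus ` c) = U"
      using surj_to_torus by (metis image_Union surj_image_vimage_eq)
    then show "\<exists>B'\<subseteq>(`) to_torus ` B. \<Union> B' = U"
      using C(1) by (intro exI[of _ "(`) to_torus ` C"]) auto
  qed
  then have "open = generate_topology ((`) to_torus ` B)"
    by (simp add: topological_basis_imp_subbasis)
  then show "\<exists>B::'a torus set set. countable B \<and> open = generate_topology B"
    using B(1) by blast
qed

instance torus :: (finite) topological_ab_group_add
proof
  fix a b :: "'a torus"
  show "((\<lambda>x. fst x + snd x) \<longlongrightarrow> a + b) (nhds a \<times>\<^sub>F nhds b)"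
  proof (rule topological_tendstoI)
    fix U :: "'a torus set" assume U: "open U" "a + b \<in> U"
    obtain x y where xy: "a = to_torus x" "b = to_torus y"
      by (metis to_torus_cases)
    have "open (to_torus -` U)" "x + y \<in> to_torus -` U"
      using U xy by (auto simp: open_torus_def to_torus_add)
    moreover have "((\<lambda>z. fst z + snd z) \<longlongrightarrow> x + y) (nhds x \<times>\<^sub>F nhds y)"
      by (rule tendsto_add_Pair)
    ultimately have "eventually (\<lambda>z. fst z + snd z \<in> to_torus -` U) (nhds x \<times>\<^sub>F nhds y)"
      by (auto dest: topological_tendstoD)
    then obtain P Q where PQ: "eventually P (nhds x)" "eventually Q (nhds y)"
        "\<And>u v. P u \<Longrightarrow> Q v \<Longrightarrow> fst (u, v) + snd (u, v) \<in> to_torus -` U"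
      unfolding eventually_prod_filter by blast
    obtain V where V: "open V" "x \<in> V" "\<And>u. u \<in> V \<Longrightarrow> P u"
      using PQ(1) unfolding eventually_nhds by blast
    obtain W where W: "open W" "y \<in> W" "\<And>u. u \<in> W \<Longrightarrow> Q u"
      using PQ(2) unfolding eventually_nhds by blast
    have "eventually (\<lambda>u. u \<in> to_torus ` V) (nhds a)"
      using V xy open_to_torus_image by (intro eventually_nhds_in_open) auto
    moreover have "eventually (\<lambda>u. u \<in> to_torus ` W) (nhds b)"
      using W xy open_to_torus_image by (intro eventually_nhds_in_open) auto
    ultimately show "eventually (\<lambda>z. fst z + snd z \<in> U) (nhds a \<times>\<^sub>F nhds b)"
      unfolding eventually_prod_filter
      using V(3) W(3) PQ(3)
      by (intro exI[of _ "\<lambda>u. u \<in> to_torus ` V"] exI[of _ "\<lambda>u. u \<in> to_torus ` W"])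
         (auto simp flip: to_torus_add)
  qed
next
  fix a :: "'a torus"
  have "continuous_on UNIV (uminus :: 'a torus \<Rightarrow> 'a torus)"
  proof (subst continuous_on_open_vimage, simp, intro allI impI)
    fix U :: "'a torus set" assume "open U"
    then have "open (uminus -` (to_torus -` U))"
      by - (rule open_vimage, auto simp: open_torus_def intro!: continuous_intros)
    moreover have "uminus -` (to_torus -` U) = to_torus -` (uminus -` U)"
      by (auto simp: to_torus_uminus)
    ultimately show "open (uminus -` U \<inter> UNIV)"
      by (simp add: open_torus_def)
  qed
  then show "(uminus \<longlongrightarrow> - a) (nhds a)"
    using continuous_on_tendsto_compose[of UNIV uminus "\<lambda>x. x" a "nhds a"]
    by (simp add: tendsto_ident_at filterlim_ident)
qed

definition add_subgroup :: "'a::ab_group_add set \<Rightarrow> bool" where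
  "add_subgroup H \<longleftrightarrow> 0 \<in> H \<and> (\<forall>x\<in>H. \<forall>y\<in>H. x + y \<in> H) \<and> (\<forall>x\<in>H. - x \<in> H)"

definition unit_cube :: "(real^'d) set" where
  "unit_cube = {x. \<forall>i. 0 \<le> x $ i \<and> x $ i < 1}"

text \<open>
  This is shown below (\<open>haar_probability_iff\<close>) to be the one and only translation-invariant
  Borel probability measure on the torus.
\<close>

definition haar_torus :: "'d::finite torus measure" where
  "haar_torus = distr (uniform_measure lborel unit_cube) borel to_torus"

lemma measurable_to_torus [measurable]: "to_torus \<in> borel_measurable borel"
  by (rule borel_measurable_continuous_onI[OF continuous_on_to_torus])

lemma unit_cube_borel [measurable]: "(unit_cube :: (real^'d) set) \<in> sets borel"
proof -
  have "(unit_cube :: (real^'d) set) = (\<Inter>i\<in>UNIV. {x. 0 \<le> x $ i} \<inter> {x. x $ i < 1})"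
    by (auto simp: unit_cube_def)
  moreover have "\<dots> \<in> sets borel"
    by (intro sets.finite_INT sets.Int borel_closed borel_open closed_Collect_le
        open_Collect_less continuous_intros) auto
  ultimately show ?thesis by simp
qed

lemma emeasure_unit_cube:
  "emeasure lborel (unit_cube :: (real^'d) set) = 1"
proof -
  have B: "b \<bullet> (1 :: real^'d) = 1" if "b \<in> Basis" for b
    using that by (auto simp: Basis_vec_def inner_axis')
  have "emeasure lborel (box 0 (1 :: real^'d)) \<le> emeasure lborel (unit_cube :: (real^'d) set)"
    by (intro emeasure_mono) (auto simp: unit_cube_def mem_box_cart less_imp_le)
  moreover have "emeasure lborel (unit_cube :: (real^'d) set) \<le> emeasure lborel (cbox 0 (1 :: real^'d))"
    by (intro emeasure_mono) (auto simp: unit_cube_def mem_box_cart less_imp_le)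
  ultimately show ?thesis
    using B by (simp add: emeasure_lborel_box_eq emeasure_lborel_cbox_eq inner_commute)
qed

lemma prob_space_haar_torus: "prob_space (haar_torus :: 'd::finite torus measure)"
proof -
  have "prob_space (uniform_measure lborel (unit_cube :: (real^'d) set))"
    by (rule prob_space_uniform_measure) (simp_all add: emeasure_unit_cube)
  then show ?thesis
    unfolding haar_torus_def by (rule prob_space.prob_space_distr) simp
qed

lemma emeasure_haar_torus:
  fixes A :: "'d::finite torus set"
  assumes "A \<in> sets borel"
  shows "emeasure haar_torus A = emeasure lborel (unit_cube \<inter> to_torus -` A)"
proof -
  have "to_torus -` A \<in> sets borel"
    using measurable_sets[OF measurable_to_torus assms] by simp
  then show ?thesis
    using assms by (simp add: haar_torus_def emeasure_distr emeasure_unit_cube divide_ennreal_def)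
qed

definition haar_probability :: "'a::{ab_group_add, topological_space} measure \<Rightarrow> bool" where
  "haar_probability \<nu> \<longleftrightarrow> sets \<nu> = sets borel \<and> prob_space \<nu> \<and>
     (\<forall>a. distr \<nu> borel (\<lambda>x. a + x) = \<nu>)"

lemma countable_int_vec: "countable (Collect int_vec :: (real^'d) set)"
proof -
  have "(Collect int_vec :: (real^'d) set) = (\<lambda>f. \<chi> i. of_int (f i)) ` (UNIV :: ('d \<Rightarrow> int) set)"
    (is "?L = ?R")
  proof
    show "?L \<subseteq> ?R"
    proof
      fix x assume "x \<in> ?L"
      then have "x = (\<chi> i. of_int \<lfloor>x $ i\<rfloor>)"
        by (auto simp: int_vec_def vec_eq_iff)
      then show "x \<in> ?R" using image_eqI[of x "\<lambda>f. \<chi> i. of_int (f i)" "\<lambda>i. \<lfloor>x $ i\<rfloor>"] by simp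
    qed
  qed (auto simp: int_vec_def)
  moreover have "countable (UNIV :: ('d \<Rightarrow> int) set)"
    by simp
  ultimately show ?thesis
    by (metis countable_image)
qed

lemma emeasure_lborel_translate:
  fixes A :: "'a::euclidean_space set"
  assumes "A \<in> sets borel"
  shows "emeasure lborel ((\<lambda>x. c + x) -` A) = emeasure lborel A"
  using assms by (subst (2) lborel_distr_plus[symmetric, of c]) (simp add: emeasure_distr)

lemma ex1_int_vec_unit_cube: "\<exists>!k. int_vec k \<and> x - k \<in> unit_cube"
proof (rule ex1I)
  show "int_vec (\<chi> i. of_int \<lfloor>x $ i\<rfloor>) \<and> x - (\<chi> i. of_int \<lfloor>x $ i\<rfloor>) \<in> unit_cube"
    by (auto simp: int_vec_def unit_cube_def) linarith
next
  fix k assume k: "int_vec k \<and> x - k \<in> unit_cube"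
  show "k = (\<chi> i. of_int \<lfloor>x $ i\<rfloor>)"
  proof (subst vec_eq_iff, intro allI)
    fix i
    obtain m where m: "k $ i = of_int m"
      using k by (auto simp: int_vec_def elim: Ints_cases)
    moreover have "0 \<le> x $ i - k $ i" "x $ i - k $ i < 1"
      using k by (auto simp: unit_cube_def)
    ultimately have "\<lfloor>x $ i\<rfloor> = m"
      by (simp add: floor_eq_iff)
    with m show "k $ i = (\<chi> i. of_int \<lfloor>x $ i\<rfloor>) $ i" by simp
  qed
qed

lemma emeasure_periodic_translate:
  fixes B :: "(real^'d) set"
  assumes B: "B \<in> sets borel" and per: "\<And>k x. int_vec k \<Longrightarrow> k + x \<in> B \<longleftrightarrow> x \<in> B"
  shows "emeasure lborel (unit_cube \<inter> (\<lambda>x. a + x) -` B) = emeasure lborel (unit_cube \<inter> B)"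
proof -
  let ?K = "Collect int_vec :: (real^'d) set"
  let ?E = "\<lambda>k. unit_cube \<inter> (\<lambda>x. a + x) -` B \<inter> (\<lambda>x. a - k + x) -` unit_cube"
  let ?F = "\<lambda>k. unit_cube \<inter> B \<inter> (\<lambda>x. k - a + x) -` unit_cube"
  have tr: "(\<lambda>x. c + x) -` S \<in> sets borel" if "S \<in> sets borel" for c and S :: "(real^'d) set"
    using measurable_sets_borel[OF _ that, of "\<lambda>x. c + x"] by simp
  have E: "?E k \<in> sets borel" and F: "?F k \<in> sets borel" for k
    using B by (auto intro!: tr sets.Int)
  have eq: "emeasure lborel (?E k) = emeasure lborel (?F k)" if "int_vec k" for k
  proof -
    have "(\<lambda>x. a - k + x) -` ?F k = ?E k"
    proof -
      have "a - k + x \<in> B \<longleftrightarrow> a + x \<in> B" for x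
        using per[of "- k" "a + x"] that by (simp add: int_vec_uminus algebra_simps)
      then show ?thesis by auto
    qed
    then show ?thesis
      using emeasure_lborel_translate[OF F, of "a - k" k] by simp
  qed
  have "emeasure lborel (unit_cube \<inter> (\<lambda>x. a + x) -` B) = emeasure lborel (\<Union>k\<in>?K. ?E k)"
  proof -
    have "\<exists>k. int_vec k \<and> a - k + x \<in> unit_cube" for x
    proof -
      obtain k where "int_vec k" "a + x - k \<in> unit_cube"
        using ex1_int_vec_unit_cube[of "a + x"] by blast
      then show ?thesis
        by (intro exI[of _ k]) (simp add: algebra_simps)
    qed
    then have "unit_cube \<inter> (\<lambda>x. a + x) -` B = (\<Union>k\<in>?K. ?E k)"
      by blast
    then show ?thesis by (simp only:)
  qed
  also have "\<dots> = (\<integral>\<^sup>+k. emeasure lborel (?E k) \<partial>count_space ?K)"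
  proof (rule emeasure_UN_countable)
    show "disjoint_family_on ?E ?K"
      unfolding disjoint_family_on_def
    proof (intro ballI impI)
      fix k l assume kl: "k \<in> ?K" "l \<in> ?K" "k \<noteq> l"
      have False if "a - k + x \<in> unit_cube" "a - l + x \<in> unit_cube" for x
      proof -
        have "a + x - k \<in> unit_cube" "a + x - l \<in> unit_cube" "int_vec k" "int_vec l"
          using that kl by (simp_all add: algebra_simps)
        then have "k = l"
          using ex1_int_vec_unit_cube[of "a + x"] by blast
        then show False using kl by simp
      qed
      then show "?E k \<inter> ?E l = {}" by auto
    qed
  qed (use E countable_int_vec in auto)
  also have "\<dots> = (\<integral>\<^sup>+k. emeasure lborel (?F k) \<partial>count_space ?K)"
    by (intro nn_integral_cong) (use eq in auto)
  also have "\<dots> = emeasure lborel (\<Union>k\<in>?K. ?F k)"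
  proof (rule emeasure_UN_countable[symmetric])
    show "disjoint_family_on ?F ?K"
      unfolding disjoint_family_on_def
    proof (intro ballI impI)
      fix k l assume kl: "k \<in> ?K" "l \<in> ?K" "k \<noteq> l"
      have False if "k - a + x \<in> unit_cube" "l - a + x \<in> unit_cube" for x
      proof -
        have "int_vec (- k)" "int_vec (- l)" "x - a - - k \<in> unit_cube" "x - a - - l \<in> unit_cube"
          using that kl by (auto simp: algebra_simps int_vec_uminus)
        then have "- k = - l"
          using ex1_int_vec_unit_cube[of "x - a"] by blast
        then show False using kl by simp
      qed
      then show "?F k \<inter> ?F l = {}" by auto
    qed
  qed (use F countable_int_vec in auto)
  also have "\<dots> = emeasure lborel (unit_cube \<inter> B)"
  proof -
    have "\<exists>k. int_vec k \<and> k - a + x \<in> unit_cube" for x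
    proof -
      obtain k where "int_vec k" "x - a - k \<in> unit_cube"
        using ex1_int_vec_unit_cube[of "x - a"] by blast
      then show ?thesis
        by (intro exI[of _ "- k"]) (auto simp: int_vec_uminus algebra_simps)
    qed
    then have "unit_cube \<inter> B = (\<Union>k\<in>?K. ?F k)"
      by blast
    then show ?thesis by (simp only:)
  qed
  finally show ?thesis .
qed

lemma haar_probability_haar_torus:
  "haar_probability (haar_torus :: 'd::finite torus measure)"
  unfolding haar_probability_def
proof (intro conjI allI)
  show "prob_space (haar_torus :: 'd torus measure)"
    by (rule prob_space_haar_torus)
  show sets: "sets (haar_torus :: 'd torus measure) = sets borel"
    by (simp add: haar_torus_def)
  fix a :: "'d torus"
  obtain x where x: "a = to_torus x" by (rule to_torus_cases)
  show "distr haar_torus borel (\<lambda>x. a + x) = haar_torus"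
  proof (rule measure_eqI)
    fix A assume "A \<in> sets (distr haar_torus borel (\<lambda>x. a + x))"
    then have A: "A \<in> sets borel" by simp
    have m: "(\<lambda>x. a + x) \<in> measurable haar_torus borel"
      by (subst measurable_cong_sets[OF sets refl]) simp
    have A': "(\<lambda>x. a + x) -` A \<in> sets borel"
      using measurable_sets_borel[OF _ A, of "\<lambda>x. a + x"] by simp
    have pA: "to_torus -` A \<in> sets borel"
      using measurable_sets[OF measurable_to_torus A] by simp
    have per: "k + y \<in> to_torus -` A \<longleftrightarrow> y \<in> to_torus -` A" if "int_vec k" for k y
      using that to_torus_eq_iff[of "k + y" y] by simp
    have "emeasure (distr haar_torus borel (\<lambda>x. a + x)) A = emeasure haar_torus ((\<lambda>x. a + x) -` A)"
      using emeasure_distr[OF m A] by (simp add: haar_torus_def)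
    also have "\<dots> = emeasure lborel (unit_cube \<inter> (\<lambda>y. x + y) -` (to_torus -` A))"
      unfolding emeasure_haar_torus[OF A'] by (simp add: x to_torus_add vimage_def)
    also have "\<dots> = emeasure lborel (unit_cube \<inter> to_torus -` A)"
      by (rule emeasure_periodic_translate[OF pA per])
    also have "\<dots> = emeasure haar_torus A"
      by (simp add: emeasure_haar_torus[OF A])
    finally show "emeasure (distr haar_torus borel (\<lambda>x. a + x)) A = emeasure haar_torus A" .
  qed (simp add: sets)
qed

lemma haar_probability_unique:
  fixes \<nu> \<nu>' :: "'a::{second_countable_topology, topological_ab_group_add} measure"
  assumes "haar_probability \<nu>" "haar_probability \<nu>'"
  shows "\<nu> = \<nu>'"
proof (rule measure_eqI)
  have s [measurable_cong]: "sets \<nu> = sets borel" "sets \<nu>' = sets borel"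
    and p: "prob_space \<nu>" "prob_space \<nu>'"
    and inv: "\<And>a. distr \<nu> borel (\<lambda>x. a + x) = \<nu>" "\<And>a. distr \<nu>' borel (\<lambda>x. a + x) = \<nu>'"
    using assms by (auto simp: haar_probability_def)
  interpret N: prob_space \<nu> by fact
  interpret N': prob_space \<nu>' by fact
  interpret pair_sigma_finite \<nu> \<nu>' ..
  show "sets \<nu> = sets \<nu>'" by (simp add: s)
  fix A assume "A \<in> sets \<nu>"
  then have A [measurable]: "A \<in> sets borel" by (simp add: s)
  have 1: "(\<integral>\<^sup>+x. indicator A (x + y) \<partial>\<nu>) = emeasure \<nu> A" for y
  proof -
    have "(\<integral>\<^sup>+x. indicator A (y + x) \<partial>\<nu>) = (\<integral>\<^sup>+x. indicator A x \<partial>distr \<nu> borel (\<lambda>x. y + x))"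
      by (subst nn_integral_distr) auto
    then show ?thesis
      using A by (simp add: inv add.commute[of _ y] s)
  qed
  have 2: "(\<integral>\<^sup>+y. indicator A (x + y) \<partial>\<nu>') = emeasure \<nu>' A" for x
  proof -
    have "(\<integral>\<^sup>+y. indicator A (x + y) \<partial>\<nu>') = (\<integral>\<^sup>+y. indicator A y \<partial>distr \<nu>' borel (\<lambda>y. x + y))"
      by (subst nn_integral_distr) auto
    then show ?thesis
      using A by (simp add: inv s)
  qed
  have "emeasure \<nu> A = (\<integral>\<^sup>+y. (\<integral>\<^sup>+x. indicator A (x + y) \<partial>\<nu>) \<partial>\<nu>')"
    by (simp add: 1 N'.emeasure_space_1)
  also have "\<dots> = (\<integral>\<^sup>+x. (\<integral>\<^sup>+y. indicator A (x + y) \<partial>\<nu>') \<partial>\<nu>)"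
    by (rule Fubini') measurable
  also have "\<dots> = emeasure \<nu>' A"
    by (simp add: 2 N.emeasure_space_1)
  finally show "emeasure \<nu> A = emeasure \<nu>' A" .
qed

theorem haar_probability_iff: "haar_probability \<nu> \<longleftrightarrow> \<nu> = haar_torus"
  using haar_probability_haar_torus haar_probability_unique by blast

lift_definition toral_endo :: "int^'d^'d \<Rightarrow> 'd torus \<Rightarrow> 'd torus"
  is "\<lambda>D x. map_matrix of_int D *v x"
  unfolding torus_rel_def
  by (simp add: int_vec_matrix_mult flip: matrix_vector_mult_diff_distrib)

lemma toral_endo_to_torus: "toral_endo D (to_torus x) = to_torus (map_matrix of_int D *v x)"
  by transfer (simp add: torus_rel_def)

definition affine_toral :: "int^'d^'d \<Rightarrow> real^'d \<Rightarrow> 'd torus \<Rightarrow> 'd torus" where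
  "affine_toral D \<alpha> x = toral_endo D x + to_torus \<alpha>"

lemma continuous_on_affine_toral: "continuous_on UNIV (affine_toral D \<alpha>)"
proof (subst continuous_on_open_vimage, simp, intro allI impI)
  fix U :: "'a torus set" assume "open U"
  then have "open ((\<lambda>x. map_matrix of_int D *v x + \<alpha>) -` (to_torus -` U))"
    by - (rule open_vimage, auto simp: open_torus_def intro!: continuous_intros)
  moreover have "(\<lambda>x. map_matrix of_int D *v x + \<alpha>) -` (to_torus -` U) = to_torus -` (affine_toral D \<alpha> -` U)"
    by (auto simp: to_torus_add affine_toral_def toral_endo_to_torus)
  ultimately show "open (affine_toral D \<alpha> -` U \<inter> UNIV)"
    by (simp add: open_torus_def)
qed

definition complex_eigenvalue :: "int^'d^'d \<Rightarrow> complex \<Rightarrow> bool" where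
  "complex_eigenvalue D z \<longleftrightarrow> (\<exists>v. v \<noteq> 0 \<and> map_matrix of_int D *v v = z *s v)"

definition expanding :: "int^'d^'d \<Rightarrow> bool" where
  "expanding D \<longleftrightarrow> (\<forall>z. complex_eigenvalue D z \<longrightarrow> cmod z > 1)"

text \<open>
  A probability measure on maps that is carried by a finite set is a \<^typ>\<open>('a \<Rightarrow> 'a) pmf\<close>; its
  set of atoms \<^const>\<open>set_pmf\<close> is its support.
\<close>

definition convolution_pmf :: "('a \<Rightarrow> 'a) pmf \<Rightarrow> 'a::topological_space measure \<Rightarrow> 'a measure" where
  "convolution_pmf \<mu> \<nu> =
     measure_of UNIV (sets borel) (\<lambda>A. \<integral>\<^sup>+g. emeasure (distr \<nu> borel g) A \<partial>measure_pmf \<mu>)"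

text \<open>The set function above is countably additive, so it is not discarded by \<^const>\<open>measure_of\<close>.\<close>

lemma emeasure_convolution_pmf:
  assumes "A \<in> sets borel"
  shows "emeasure (convolution_pmf \<mu> \<nu>) A = (\<integral>\<^sup>+g. emeasure (distr \<nu> borel g) A \<partial>measure_pmf \<mu>)"
proof (rule emeasure_measure_of[OF convolution_pmf_def])
  let ?f = "\<lambda>A. \<integral>\<^sup>+g. emeasure (distr \<nu> borel g) A \<partial>measure_pmf \<mu>"
  show "sets borel \<subseteq> Pow UNIV" by simp
  show "A \<in> sets (convolution_pmf \<mu> \<nu>)"
    using assms sets.sigma_sets_eq[of "borel :: 'a measure"] by (simp add: convolution_pmf_def)
  show "positive (sets (convolution_pmf \<mu> \<nu>)) ?f"
    by (simp add: positive_def)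
  show "countably_additive (sets (convolution_pmf \<mu> \<nu>)) ?f"
    unfolding countably_additive_def
  proof (intro allI impI)
    fix F :: "nat \<Rightarrow> 'a set"
    assume "range F \<subseteq> sets (convolution_pmf \<mu> \<nu>)" and F: "disjoint_family F"
    then have "range F \<subseteq> sets (distr \<nu> borel g)" for g
      using sets.sigma_sets_eq[of "borel :: 'a measure"] by (simp add: convolution_pmf_def)
    then have "emeasure (distr \<nu> borel g) (\<Union>i. F i) = (\<Sum>i. emeasure (distr \<nu> borel g) (F i))" for g
      using F by (simp add: suminf_emeasure)
    then show "(\<Sum>i. ?f (F i)) = ?f (\<Union>i. F i)"
      by (simp add: nn_integral_suminf)
  qed
qed

definition stationary :: "('a \<Rightarrow> 'a) pmf \<Rightarrow> 'a::topological_space measure \<Rightarrow> bool" where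
  "stationary \<mu> \<nu> \<longleftrightarrow> sets \<nu> = sets borel \<and> prob_space \<nu> \<and> convolution_pmf \<mu> \<nu> = \<nu>"

end

theory Submission
  imports Defs "HOL-Computational_Algebra.Fundamental_Theorem_Algebra"
begin

text \<open>
  Write \<open>\<phi> k\<close> for the Fourier coefficient of a stationary measure \<open>\<nu>\<close> at the integer vector \<open>k\<close>, and
  \<open>R i\<close> for the real matrix of \<open>D i\<close>. Since the character \<open>k\<close> composed with \<open>h i\<close> is \<open>e(k \<bullet> \<alpha> i)\<close> times
  the character \<open>k v* R i\<close>, where \<open>e(x) = cis (2 * pi * x)\<close>, stationarity says
  that \<open>\<phi> k\<close> is the \<open>\<mu>\<close>-average of the numbers \<open>e(k \<bullet> \<alpha> i) * \<phi> (k v* R i)\<close>. Because measures on the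
  torus are determined by their Fourier coefficients (\<open>torus_measure_eqI\<close>), it is enough to show
  that \<open>\<phi>\<close> vanishes off \<open>0\<close>; this is \<open>twisted_harmonic_vanishes\<close>.

  Let \<open>S\<close> be the supremum of \<open>|\<phi>|\<close> over nonzero integer vectors and suppose \<open>S > 0\<close>. An
  average of numbers of modulus at most \<open>S\<close> can have modulus close to \<open>S\<close> only if all
  these numbers are close to the average (\<open>averages_near_maximum\<close>). So along frequencies
  \<open>k\<close> for which \<open>|\<phi> k|\<close> tends to \<open>S\<close>, one step by any letter \<open>i\<close> hardly changes the
  value, and the frequencies \<open>k v* R i\<close> are again nearly maximal. Taking two steps in the orders
  \<open>i j\<close> and \<open>j i\<close> leads to the same frequency, because the matrices commute, but with phases that
  differ by the factor \<open>e(k \<bullet> t i j)\<close>, where \<open>t i j = (1 - R i) \<alpha> j - (1 - R j) \<alpha> i\<close>. Hence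
  \<open>k \<bullet> t i j\<close> is close to an integer. For any finite set of products \<open>B\<close> of the \<open>R i\<close> the
  frequencies \<open>k v* B\<close> are nearly maximal too, so that \<open>k \<bullet> (B *v t i j)\<close> is also close to an integer.

  Since \<open>|\<phi> k|\<close> is at most an average of the \<open>|\<phi> (k v* R i)|\<close>, some letter does not decrease
  \<open>|\<phi>|\<close>. Starting at a nearly maximal \<open>\<xi> 0\<close> one can therefore follow an infinite path
  \<open>\<xi> (m + 1) = \<xi> m v* R (b m)\<close> that stays nearly maximal for ever, along which all the numbers
  \<open>\<xi> m \<bullet> (B *v t i j)\<close> stay close to integers. Expansion makes this impossible unless
  \<open>\<xi> 0 \<bullet> t i j\<close> is an integer (\<open>integer_of_small_orbit\<close>): the differences to the nearest integers
  satisfy an exact linear recursion driven by the expanding matrices, and a solution that remains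
  bounded must vanish. Then the character \<open>\<xi> 0\<close> is trivial on all the points \<open>t i j\<close>, so its kernel is
  a closed subgroup containing them, hence the whole torus, and \<open>\<xi> 0 = 0\<close>, a contradiction.

  Conversely Haar measure is stationary, because every \<open>h i\<close> is a translate of a surjective
  endomorphism and such maps preserve it.
\<close>

section \<open>Backward orbits of commuting expanding matrices\<close>

text \<open>
  The vector \<open>p(C) z\<close> for a polynomial \<open>p\<close>, evaluated by Horner's scheme.
\<close>
definition poly_act :: "complex^'d^'d \<Rightarrow> complex poly \<Rightarrow> complex^'d \<Rightarrow> complex^'d" where
  "poly_act C p z = fold_coeffs (\<lambda>a y. a *s z + C *v y) p 0"

lemma poly_act_0 [simp]: "poly_act C 0 z = 0"
  by (simp add: poly_act_def)

lemma poly_act_pCons [simp]: "poly_act C (pCons a p) z = a *s z + C *v poly_act C p z"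
  by (cases "p = 0 \<and> a = 0") (auto simp: poly_act_def)

lemma poly_act_add: "poly_act C (p + q) z = poly_act C p z + poly_act C q z"
  by (induction p q rule: poly_induct2)
     (simp_all add: matrix_vector_right_distrib vec.scale_left_distrib)

lemma poly_act_smult: "poly_act C (smult c p) z = c *s poly_act C p z"
  by (induction p) (simp_all add: vec.scale_right_distrib vec.scale mult.commute)

lemma poly_act_linear_factor:
  "poly_act C ([:- r, 1:] * q) z = C *v poly_act C q z - r *s poly_act C q z"
proof -
  have "[:- r, 1:] * q = smult (- r) q + pCons 0 q" by simp
  then show ?thesis by (simp only: poly_act_smult poly_act_add poly_act_pCons) simp
qed

lemma poly_act_monom: "poly_act C (monom c i) z = c *s (((*v) C ^^ i) z)"
  by (induction i) (simp_all add: monom_0 monom_Suc vec.scale)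

lemma poly_act_sum: "poly_act C (\<Sum>i\<in>A. f i) z = (\<Sum>i\<in>A. poly_act C (f i) z)"
  by (induction A rule: infinite_finite_induct) (simp_all add: poly_act_add)

text \<open>
  The first \<open>CARD('d) + 1\<close> iterates of \<open>z\<close> under \<open>C\<close> cannot be linearly independent. A relation
  between distinct iterates gives the polynomial, and so does a repetition among them.
\<close>
lemma ex_annihilating_poly:
  fixes C :: "complex^'d^'d"
  shows "\<exists>p. p \<noteq> 0 \<and> poly_act C p z = 0"
proof -
  define f where "f i = ((*v) C ^^ i) z" for i
  let ?N = "{..CARD('d)}"
  show ?thesis
  proof (cases "inj_on f ?N")
    case False
    then obtain i j where ij: "i \<noteq> j" "f i = f j"
      by (auto simp: inj_on_def)
    have "monom 1 i - monom (1::complex) j \<noteq> 0"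
      using ij by (simp add: monom_eq_iff')
    moreover have "poly_act C (monom 1 i + monom (-1) j) z = 0"
      using ij by (simp add: poly_act_add poly_act_monom f_def)
    ultimately show ?thesis
      by (metis minus_monom add_uminus_conv_diff)
  next
    case True
    then have "card (f ` ?N) > CARD('d)"
      by (simp add: card_image)
    moreover have "vec.dim (f ` ?N) \<le> CARD('d)"
      using vec.dim_subset[OF subset_UNIV, of "f ` ?N"] unfolding vec_dim_card .
    ultimately have "vec.dependent (f ` ?N)"
      by (intro vec.dependent_biggerset_general) simp
    then obtain u where u: "(\<Sum>v\<in>f ` ?N. u v *s v) = 0" "\<exists>v\<in>f ` ?N. u v \<noteq> 0"
      using vec.dependent_finite[of "f ` ?N"] by auto
    then obtain k where k: "k \<in> ?N" "u (f k) \<noteq> 0" by auto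
    define p where "p = (\<Sum>i\<in>?N. monom (u (f i)) i)"
    have "coeff p k = u (f k)"
      using k by (simp add: p_def coeff_sum sum.delta')
    then have "p \<noteq> 0" using k by auto
    moreover have "poly_act C p z = 0"
      using u(1) unfolding sum.reindex[OF True]
      by (simp add: p_def poly_act_sum poly_act_monom flip: f_def)
    ultimately show ?thesis by blast
  qed
qed

text \<open>
  An eigenvector of the operator induced by \<open>C\<close> on the quotient of \<open>E\<close> by \<open>W\<close>, without forming
  the quotient. For a polynomial \<open>p\<close> of least degree with \<open>p(C) z\<close> in \<open>W\<close>, split off a root:
  \<open>p = (X - r) q\<close>; then \<open>q(C) z\<close> is such an eigenvector, by minimality.
\<close>
lemma ex_eigenvector_mod_subspace:
  fixes C :: "complex^'d^'d"
  assumes E: "\<And>x. x \<in> E \<Longrightarrow> C *v x \<in> E" "vec.subspace E"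
    and W: "vec.subspace W" and z: "z \<in> E" "z \<notin> W"
  shows "\<exists>l y. y \<in> E \<and> y \<notin> W \<and> C *v y - l *s y \<in> W"
proof -
  define P where "P p \<longleftrightarrow> p \<noteq> 0 \<and> poly_act C p z \<in> W" for p
  have ex: "\<exists>p. P p"
    using ex_annihilating_poly[of C z] vec.subspace_0[OF W] unfolding P_def by metis
  define p where "p = arg_min degree P"
  have p: "P p" and min: "\<And>q. P q \<Longrightarrow> degree p \<le> degree q"
    using ex unfolding p_def by (metis arg_min_natI, metis arg_min_nat_le)
  have "degree p \<noteq> 0"
  proof
    assume "degree p = 0"
    then obtain a where a: "p = [:a:]" by (metis degree_eq_zeroE)
    with p have "a \<noteq> 0" "a *s z \<in> W" by (auto simp: P_def)
    then have "inverse a *s (a *s z) \<in> W" using W vec.subspace_scale by blast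
    then show False using z \<open>a \<noteq> 0\<close> by (simp add: vec.scale_scale)
  qed
  then obtain r where "poly p r = 0"
    using fundamental_theorem_of_algebra[of p] by (auto simp: constant_degree)
  then obtain q where q: "p = [:- r, 1:] * q"
    by (metis poly_eq_0_iff_dvd dvdE)
  have "q \<noteq> 0" using p q by (auto simp: P_def)
  then have "degree q < degree p"
    by (simp add: q degree_mult_eq del: mult_pCons_left)
  then have "poly_act C q z \<notin> W"
    using min[of q] \<open>q \<noteq> 0\<close> by (auto simp: P_def)
  moreover have "poly_act C q z \<in> E"
    using E z by (induction q) (auto intro: vec.subspace_add vec.subspace_scale vec.subspace_0)
  moreover have "C *v poly_act C q z - r *s poly_act C q z \<in> W"
    using p unfolding P_def q poly_act_linear_factor by simp
  ultimately show ?thesis by blast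
qed

text \<open>
  The vectors that are eigenvectors modulo \<open>W\<close> for the matrices treated so far, with prescribed
  eigenvalues, form a space that every further matrix preserves, because the matrices commute.
  So one more eigenvector can be chosen inside it.
\<close>
lemma ex_common_eigenvector_mod_subspace:
  fixes C :: "'i \<Rightarrow> complex^'d^'d"
  assumes "finite I"
    and comm: "\<And>i j. i \<in> I \<Longrightarrow> j \<in> I \<Longrightarrow> C i ** C j = C j ** C i"
    and W: "vec.subspace W" "\<And>i x. i \<in> I \<Longrightarrow> x \<in> W \<Longrightarrow> C i *v x \<in> W" "W \<noteq> UNIV"
  shows "\<exists>l y. y \<notin> W \<and> (\<forall>i\<in>I. C i *v y - l i *s y \<in> W)"
proof -
  have "\<exists>l y. y \<notin> W \<and> (\<forall>i\<in>J. C i *v y - l i *s y \<in> W)" if "finite J" "J \<subseteq> I" for J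
    using that
  proof (induction J rule: finite_induct)
    case empty
    then show ?case using W by auto
  next
    case (insert j J)
    then obtain l z where z: "z \<notin> W" "\<forall>i\<in>J. C i *v z - l i *s z \<in> W" by auto
    define E where "E = {y. \<forall>i\<in>J. C i *v y - l i *s y \<in> W}"
    have "vec.subspace E"
    proof (rule vec.subspaceI)
      show "0 \<in> E" using W by (simp add: E_def vec.subspace_0)
      show "x + y \<in> E" if "x \<in> E" "y \<in> E" for x y
      proof -
        have "C i *v (x + y) - l i *s (x + y) = (C i *v x - l i *s x) + (C i *v y - l i *s y)" for i
          by (simp add: matrix_vector_right_distrib vec.scale_right_distrib)
        then show ?thesis
          using that vec.subspace_add[OF W(1)] unfolding E_def mem_Collect_eq by presburger
      qed
      show "c *s x \<in> E" if "x \<in> E" for x c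
      proof -
        have "C i *v (c *s x) - l i *s (c *s x) = c *s (C i *v x - l i *s x)" for i
          by (simp add: vec.scale vec.scale_right_diff_distrib mult.commute)
        then show ?thesis
          using that vec.subspace_scale[OF W(1)] unfolding E_def mem_Collect_eq by presburger
      qed
    qed
    moreover have "C j *v x \<in> E" if "x \<in> E" for x
    proof -
      have "C i *v (C j *v x) - l i *s (C j *v x) = C j *v (C i *v x - l i *s x)" if "i \<in> J" for i
        using comm[of i j] that insert.prems
        by (simp add: matrix_vector_mult_diff_distrib vec.scale matrix_vector_mul_assoc subset_iff)
      then show ?thesis using that W insert.prems by (auto simp: E_def)
    qed
    ultimately obtain r y where "y \<in> E" "y \<notin> W" "C j *v y - r *s y \<in> W"
      using ex_eigenvector_mod_subspace[of E "C j" W z] W z by (auto simp: E_def)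
    then show ?case
      using insert.hyps by (intro exI[of _ "l(j := r)"] exI[of _ y]) (auto simp: E_def)
  qed
  then show ?thesis using assms(1) by blast
qed

text \<open>
  An eigenvalue on the quotient by an invariant subspace is a genuine eigenvalue: if \<open>C - l\<close> were
  injective, then it would map \<open>W\<close> onto \<open>W\<close>, so that a vector mapped into \<open>W\<close> would lie in \<open>W\<close>.
\<close>
lemma eigenvalue_of_eigenvector_mod_subspace:
  fixes C :: "complex^'d^'d"
  assumes W: "vec.subspace W" "\<And>x. x \<in> W \<Longrightarrow> C *v x \<in> W"
    and y: "y \<notin> W" "C *v y - l *s y \<in> W"
  shows "\<exists>v. v \<noteq> 0 \<and> C *v v = l *s v"
proof (rule ccontr)
  assume neg: "\<not> ?thesis"
  define M where "M = C - mat l"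
  have M: "M *v x = C *v x - l *s x" for x
  proof -
    have "mat l *v x = l *s x"
      by (simp add: mat_def matrix_vector_mult_def vec_eq_iff if_distrib[of "\<lambda>c. c * _"] cong: if_cong)
    then show ?thesis by (simp add: M_def matrix_vector_mult_diff_rdistrib)
  qed
  have inj: "inj ((*v) M)"
    using neg by (subst vec.inj_iff_eq_0) (auto simp: M)
  have "(*v) M ` W \<subseteq> W"
    using W by (auto simp: M intro: vec.subspace_diff vec.subspace_scale)
  moreover have "vec.subspace ((*v) M ` W)"
    using W(1) by (rule vec.linear_subspace_image[OF matrix_vector_mul_linear_gen])
  moreover have "vec.dim ((*v) M ` W) = vec.dim W"
    using inj by (intro vec.dim_image_eq matrix_vector_mul_linear_gen) (auto simp: inj_on_def)
  ultimately have "(*v) M ` W = W"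
    using W vec.subspace_dim_equal by (metis order_refl)
  then obtain w where "w \<in> W" "M *v w = M *v y"
    using y by (metis M imageE)
  then show False using inj y by (auto dest: injD)
qed

lemma contracting_recursion_tendsto_0:
  fixes a r :: "nat \<Rightarrow> real"
  assumes q: "0 \<le> q" "q < 1" and a: "\<And>m. 0 \<le> a m" "\<And>m. a (Suc m) \<le> q * (a m + r m)"
    and r: "r \<longlonglongrightarrow> 0"
  shows "a \<longlonglongrightarrow> 0"
proof (rule LIMSEQ_I)
  fix e :: real assume "e > 0"
  define d where "d = e / 2 * (1 - q)"
  have "d > 0" using \<open>e > 0\<close> q by (simp add: d_def)
  then obtain N where N: "\<And>m. m \<ge> N \<Longrightarrow> \<bar>r m\<bar> < d"
    using LIMSEQ_D[OF r] by (auto simp: real_norm_def)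
  have bd: "a (N + k) \<le> q ^ k * a N + e / 2" for k
  proof (induction k)
    case 0
    then show ?case using \<open>e > 0\<close> by simp
  next
    case (Suc k)
    have "a (N + Suc k) \<le> q * (a (N + k) + r (N + k))"
      using a(2)[of "N + k"] by simp
    also have "\<dots> \<le> q * (q ^ k * a N + e / 2 + d)"
      using Suc.IH N[of "N + k"] q by (intro mult_left_mono) auto
    also have "\<dots> \<le> q ^ Suc k * a N + e / 2"
    proof -
      have "q * d \<le> d" using q \<open>d > 0\<close> by (simp add: mult_le_cancel_right1)
      moreover have "q * (e / 2) + d = e / 2" by (simp add: d_def field_simps)
      ultimately show ?thesis by (simp add: algebra_simps)
    qed
    finally show ?case .
  qed
  have "(\<lambda>k. q ^ k * a N) \<longlonglongrightarrow> 0"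
    using q by (intro tendsto_mult_left_zero LIMSEQ_realpow_zero)
  then obtain K where K: "\<And>k. k \<ge> K \<Longrightarrow> \<bar>q ^ k * a N\<bar> < e / 2"
    using LIMSEQ_D[of "\<lambda>k. q ^ k * a N" 0 "e/2"] \<open>e > 0\<close> by auto
  have "norm (a m - 0) < e" if "m \<ge> N + K" for m
  proof -
    have "a m \<le> q ^ (m - N) * a N + e / 2" "\<bar>q ^ (m - N) * a N\<bar> < e / 2"
      using bd[of "m - N"] K[of "m - N"] that by auto
    then have "a m < e" by linarith
    then show ?thesis using a(1)[of m] by simp
  qed
  then show "\<exists>no. \<forall>m\<ge>no. norm (a m - 0) < e" by blast
qed

text \<open>
  Products of inverses of commuting expanding matrices tend to \<open>0\<close>, whatever sequence of
  factors is chosen. The initial vectors \<open>z\<close> whose backward orbit tends to \<open>0\<close> form a subspace \<open>W\<close>, which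
  is invariant because the matrices commute. If \<open>W\<close> were proper, there would be a common
  eigenvector \<open>z\<close> modulo \<open>W\<close>. Its eigenvalues have modulus greater than \<open>1\<close>, so its backward
  orbit is divided by such a number at each step, up to an error that comes from \<open>W\<close> and tends to
  \<open>0\<close>. Hence the orbit of \<open>z\<close> would tend to \<open>0\<close> as well.
\<close>
lemma backward_orbit_tendsto_0:
  fixes C :: "'i \<Rightarrow> complex^'d^'d"
  assumes I: "finite I" "\<And>m. b m \<in> I"
    and comm: "\<And>i j. i \<in> I \<Longrightarrow> j \<in> I \<Longrightarrow> C i ** C j = C j ** C i"
    and exp: "\<And>i l v. i \<in> I \<Longrightarrow> v \<noteq> 0 \<Longrightarrow> C i *v v = l *s v \<Longrightarrow> cmod l > 1"
    and y: "\<And>m. C (b m) *v y (Suc m) = y m"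
  shows "y \<longlonglongrightarrow> 0"
proof -
  define bwd where "bwd y \<longleftrightarrow> (\<forall>m. C (b m) *v y (Suc m) = y m)" for y
  define W where "W = {z. \<exists>y. y 0 = z \<and> bwd y \<and> y \<longlonglongrightarrow> 0}"
  have inj: "inj ((*v) (C i))" if "i \<in> I" for i
    using exp[OF that, of _ 0] by (subst vec.inj_iff_eq_0) auto
  then have surj: "surj ((*v) (C i))" if "i \<in> I" for i
    using that by (intro vec.linear_inj_imp_surj) auto
  have unique: "u m = v m" if "bwd u" "bwd v" "u 0 = v 0" for u v m
  proof (induction m)
    case (Suc m)
    then have "C (b m) *v u (Suc m) = C (b m) *v v (Suc m)"
      using that by (simp add: bwd_def)
    then show ?case using inj[OF I(2)] by (auto dest: injD)
  qed (use that in simp)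
  have W: "vec.subspace W"
  proof (rule vec.subspaceI)
    show "0 \<in> W" by (auto simp: W_def bwd_def intro!: exI[of _ "\<lambda>_. 0"])
    show "x + x' \<in> W" if x: "x \<in> W" "x' \<in> W" for x x'
    proof -
      obtain u v where "u 0 = x" "v 0 = x'" "bwd u" "bwd v" "u \<longlonglongrightarrow> 0" "v \<longlonglongrightarrow> 0"
        using x unfolding W_def by blast
      then show ?thesis
        unfolding W_def mem_Collect_eq
        using tendsto_add[of u 0 sequentially v 0]
        by (intro exI[of _ "\<lambda>m. u m + v m"]) (simp add: bwd_def matrix_vector_right_distrib)
    qed
    show "c *s x \<in> W" if x: "x \<in> W" for x c
    proof -
      obtain u where u: "u 0 = x" "bwd u" "u \<longlonglongrightarrow> 0"
        using x unfolding W_def by blast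
      have "(\<lambda>m. c *s u m) \<longlonglongrightarrow> c *s 0"
        using u(3) by (intro vec_tendstoI) (auto intro!: tendsto_eq_intros dest: tendsto_vec_nth)
      then show ?thesis
        unfolding W_def mem_Collect_eq using u
        by (intro exI[of _ "\<lambda>m. c *s u m"]) (simp add: bwd_def vec.scale)
    qed
  qed
  have W_inv: "C i *v x \<in> W" if i: "i \<in> I" and x: "x \<in> W" for i x
  proof -
    obtain u where u: "u 0 = x" "bwd u" "u \<longlonglongrightarrow> 0"
      using x unfolding W_def by blast
    have "(\<lambda>m. C i *v u m) \<longlonglongrightarrow> C i *v 0"
      using u(3) by (intro isCont_tendsto_compose[of _ "(*v) (C i)"] matrix_vector_mult_linear_continuous_at)
    moreover have "bwd (\<lambda>m. C i *v u m)"
      using u(2) comm[OF i I(2)] unfolding bwd_def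
      by (metis matrix_vector_mul_assoc)
    ultimately show ?thesis
      unfolding W_def mem_Collect_eq using u(1)
      by (intro exI[of _ "\<lambda>m. C i *v u m"]) simp
  qed
  have "W = UNIV"
  proof (rule ccontr)
    assume "W \<noteq> UNIV"
    then obtain l z where z: "z \<notin> W" "\<And>i. i \<in> I \<Longrightarrow> C i *v z - l i *s z \<in> W"
      using ex_common_eigenvector_mod_subspace[of I C W, OF I(1) comm W W_inv] by auto
    have l: "cmod (l i) > 1" if "i \<in> I" for i
      using eigenvalue_of_eigenvector_mod_subspace[OF W W_inv[OF that] z(1) z(2)[OF that]] exp[OF that]
      by auto
    define u where "u = rec_nat z (\<lambda>m x. inv ((*v) (C (b m))) x)"
    have u: "u 0 = z" "bwd u"
      using surj[OF I(2)] by (simp_all add: u_def bwd_def surj_f_inv_f)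
    define r where "r i m = C i *v u m - l i *s u m" for i m
    (* The defect of u from being an eigenvector is itself a backward orbit, starting in W. *)
    have r: "(\<lambda>m. norm (r i m)) \<longlonglongrightarrow> 0" if i: "i \<in> I" for i
    proof -
      obtain v where v: "v 0 = C i *v z - l i *s z" "bwd v" "v \<longlonglongrightarrow> 0"
        using z(2)[OF i] unfolding W_def by blast
      have "bwd (r i)"
        unfolding bwd_def
      proof
        fix m
        have "C (b m) *v r i (Suc m) = C i *v (C (b m) *v u (Suc m)) - l i *s (C (b m) *v u (Suc m))"
          using comm[OF i I(2)]
          by (simp add: r_def matrix_vector_mult_diff_distrib vec.scale matrix_vector_mul_assoc)
        then show "C (b m) *v r i (Suc m) = r i m"
          using u(2) by (simp add: bwd_def r_def)
      qed
      then have "r i = v"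
        using unique[of "r i" v] v u by (auto simp: r_def)
      then show ?thesis using v(3) tendsto_norm_zero by auto
    qed
    define L where "L = Min ((\<lambda>i. cmod (l i)) ` I)"
    have "I \<noteq> {}" using I(2) by auto
    then have L: "L > 1" "\<And>i. i \<in> I \<Longrightarrow> L \<le> cmod (l i)"
      using I(1) l by (auto simp: L_def)
    define \<rho> where "\<rho> m = (\<Sum>i\<in>I. norm (r i m))" for m
    have "\<rho> \<longlonglongrightarrow> 0"
      unfolding \<rho>_def using r by (rule tendsto_null_sum)
    then have rho: "(\<lambda>m. \<rho> (Suc m)) \<longlonglongrightarrow> 0" by (rule LIMSEQ_Suc)
    have "norm (u (Suc m)) \<le> inverse L * (norm (u m) + \<rho> (Suc m))" for m
    proof -
      have "l (b m) *s u (Suc m) = u m - r (b m) (Suc m)"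
        using u(2) by (simp add: r_def bwd_def)
      then have "norm (l (b m) *s u (Suc m)) \<le> norm (u m) + norm (r (b m) (Suc m))"
        by (simp only: norm_triangle_ineq4)
      also have "norm (r (b m) (Suc m)) \<le> \<rho> (Suc m)"
        unfolding \<rho>_def using I by (intro member_le_sum) auto
      also have "norm (l (b m) *s u (Suc m)) = cmod (l (b m)) * norm (u (Suc m))"
        by (simp add: norm_vec_def norm_mult L2_set_right_distrib)
      finally have "cmod (l (b m)) * norm (u (Suc m)) \<le> norm (u m) + \<rho> (Suc m)" by simp
      moreover have "L * norm (u (Suc m)) \<le> cmod (l (b m)) * norm (u (Suc m))"
        using L(2)[OF I(2)] by (intro mult_right_mono) auto
      ultimately show ?thesis using L(1) by (simp add: field_simps)
    qed
    then have "(\<lambda>m. norm (u m)) \<longlonglongrightarrow> 0"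
      using L(1) by (intro contracting_recursion_tendsto_0[OF _ _ _ _ rho, of "inverse L"])
        (simp_all add: inverse_less_1_iff)
    then have "u \<longlonglongrightarrow> 0" by (simp add: tendsto_norm_zero_iff)
    then have "z \<in> W"
      unfolding W_def using u by (intro CollectI exI[of _ u]) simp
    then show False using z(1) by contradiction
  qed
  then obtain v where v: "v 0 = y 0" "bwd v" "v \<longlonglongrightarrow> 0" unfolding W_def by blast
  have "bwd y" using y by (simp add: bwd_def)
  have "y m = v m" for m
    by (rule unique[OF \<open>bwd y\<close> v(2)]) (simp add: v(1))
  then have "y = v" by (rule ext)
  then show ?thesis using v(3) by simp
qed

section \<open>Orbits of integer matrices that stay near the integers\<close>

definition rat_scale :: "rat \<Rightarrow> real \<Rightarrow> real" where
  "rat_scale q x = of_rat q * x"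

text \<open>
  Linear extension of the identity of \<open>\<rat>\<close> to the rational vector space of reals.
\<close>
lemma ex_additive_retraction_onto_Rats:
  "\<exists>p :: real \<Rightarrow> real. (\<forall>x. p x \<in> \<rat>) \<and> (\<forall>x y. p (x + y) = p x + p y) \<and>
     (\<forall>q\<in>\<rat>. \<forall>x. p (q * x) = q * p x) \<and> p 1 = 1"
proof -
  interpret pr: vector_space_pair rat_scale "(*) :: rat \<Rightarrow> rat \<Rightarrow> rat"
    by unfold_locales (auto simp: rat_scale_def algebra_simps of_rat_add of_rat_mult)
  have "pr.vs1.independent {1}" by (simp add: pr.vs1.dependent_single)
  then obtain g where g: "Vector_Spaces.linear rat_scale (*) g" "g 1 = 1"
    using pr.linear_independent_extend[of "{1}" "\<lambda>_. 1"] by auto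
  interpret g: Vector_Spaces.linear rat_scale "(*)" g by fact
  show ?thesis
    using g.add g.scale g(2)
    by (intro exI[of _ "\<lambda>x. of_rat (g x)"])
       (auto simp: of_rat_add of_rat_mult rat_scale_def elim!: Rats_cases)
qed

text \<open>
  \<open>X v\<close> is the coordinate at \<open>v\<close> with respect to \<open>V\<close>. Applying a \<open>\<rat>\<close>-linear retraction of the
  reals onto \<open>\<rat>\<close> to the coordinates of \<open>x\<close> yields another expansion of \<open>x\<close>, since all vectors
  have rational entries; by uniqueness of coordinates nothing has changed.
\<close>
lemma rational_coordinates:
  fixes V :: "'a::euclidean_space set"
  assumes V: "finite V" "independent V"
    and X: "\<And>v. linear (X v :: 'a \<Rightarrow> real)" "\<And>v w. v \<in> V \<Longrightarrow> w \<in> V \<Longrightarrow> X v w = (if v = w then 1 else 0)"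
    and rat: "\<And>v b. v \<in> V \<Longrightarrow> b \<in> Basis \<Longrightarrow> v \<bullet> b \<in> \<rat>" 
    and x: "x \<in> span V" "\<And>b. b \<in> Basis \<Longrightarrow> x \<bullet> b \<in> \<rat>" and w: "w \<in> V"
  shows "X w x \<in> \<rat>"
proof -
  obtain p :: "real \<Rightarrow> real" where p: "\<And>x. p x \<in> \<rat>" "\<And>x y. p (x + y) = p x + p y"
     "\<And>q x. q \<in> \<rat> \<Longrightarrow> p (q * x) = q * p x" "p 1 = 1"
    using ex_additive_retraction_onto_Rats by blast
  have p0: "p 0 = 0" using p(3)[of 0 0] by simp
  have psum: "p (sum f A) = (\<Sum>i\<in>A. p (f i))" for f :: "'a \<Rightarrow> real" and A
    by (induction A rule: infinite_finite_induct) (simp_all add: p p0)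
  have pq: "p q = q" if "q \<in> \<rat>" for q
    using p(3)[OF that, of 1] p(4) by simp
  obtain c where c: "x = (\<Sum>v\<in>V. c v *\<^sub>R v)"
    using x(1) V(1) by (auto simp: span_finite)
  have "x = (\<Sum>v\<in>V. p (c v) *\<^sub>R v)"
  proof (rule euclidean_eqI)
    fix b :: 'a assume b: "b \<in> Basis"
    have "x \<bullet> b = p (x \<bullet> b)" using pq x(2)[OF b] by simp
    also have "\<dots> = (\<Sum>v\<in>V. p (c v * (v \<bullet> b)))"
      by (simp add: c inner_sum_left psum)
    also have "\<dots> = (\<Sum>v\<in>V. p (c v) *\<^sub>R v) \<bullet> b"
      using p(3)[OF rat[OF _ b]] by (auto simp: inner_sum_left mult.commute intro!: sum.cong)
    finally show "x \<bullet> b = (\<Sum>v\<in>V. p (c v) *\<^sub>R v) \<bullet> b" .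
  qed
  then have "X w x = (\<Sum>v\<in>V. p (c v) * X w v)"
    by (simp add: linear_sum[OF X(1)] linear_scale[OF X(1)])
  also have "\<dots> = p (c w)"
  proof -
    have "(\<Sum>v\<in>V. p (c v) * X w v) = (\<Sum>v\<in>V. if w = v then p (c v) else 0)"
      using X(2)[OF w] by (intro sum.cong) auto
    then show ?thesis using V(1) w by simp
  qed
  finally show ?thesis using p(1) by simp
qed

lemma common_denominator:
  fixes f :: "'a \<Rightarrow> real"
  assumes "finite A" "\<And>a. a \<in> A \<Longrightarrow> f a \<in> \<rat>"
  shows "\<exists>q::nat. q > 0 \<and> (\<forall>a\<in>A. real q * f a \<in> \<int>)"
  using assms
proof (induction A rule: finite_induct)
  case (insert a A)
  then obtain q where q: "q > 0" "\<forall>a\<in>A. real q * f a \<in> \<int>" by auto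
  obtain m n where mn: "n > 0" "f a = of_int m / of_int n"
    using insert.prems[of a] by (auto elim!: Rats_cases')
  have "real (q * nat n) * f b \<in> \<int>" if "b \<in> insert a A" for b
  proof (cases "b = a")
    case True
    then have "real (q * nat n) * f b = of_int (int q * m)"
      using mn by simp
    then show ?thesis by (simp only: Ints_of_int)
  next
    case False
    then have "real q * f b \<in> \<int>"
      using q that by blast
    then have "real (nat n) * (real q * f b) \<in> \<int>"
      by (rule Ints_mult[OF Ints_of_nat])
    then show ?thesis by (simp add: mult_ac)
  qed
  then show ?case using q mn by (intro exI[of _ "q * nat n"]) auto
qed (use zero_less_one in blast)

text \<open>
  The products of the matrices \<open>R i\<close>. A product is built up by multiplying on the left, so that the
  row vector \<open>k v* B\<close> is reached from \<open>k\<close> by steps \<open>k \<mapsto> k v* R i\<close>.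
\<close>
inductive_set matrix_monoid :: "('i \<Rightarrow> real^'d^'d) \<Rightarrow> 'i set \<Rightarrow> (real^'d^'d) set"
  for R I where
    one: "mat 1 \<in> matrix_monoid R I"
  | step: "i \<in> I \<Longrightarrow> B \<in> matrix_monoid R I \<Longrightarrow> R i ** B \<in> matrix_monoid R I"

lemma matrix_mult_span_closed:
  assumes "i \<in> I" "B \<in> span (matrix_monoid R I)"
  shows "R i ** B \<in> span (matrix_monoid R I)"
  using assms(2)
proof (induction B rule: span_induct_alt)
  case base
  then show ?case by (simp add: span_zero)
next
  case (step c A B)
  have "R i ** (c *\<^sub>R A + B) = c *\<^sub>R (R i ** A) + R i ** B"
    by (simp add: matrix_add_ldistrib matrix_scalar_ac scalar_matrix_assoc)
  then show ?case
    using step assms(1) by (simp add: span_add span_scale span_base matrix_monoid.step)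
qed

lemma linear_matrix_mult_left: "linear (\<lambda>B :: real^'d^'d. A ** B)"
  by (rule linearI) (simp_all add: matrix_add_ldistrib matrix_scalar_ac scalar_matrix_assoc)

lemma linear_matrix_vector_left: "linear (\<lambda>A :: real^'n^'m. A *v x)"
  by (rule linearI) (simp_all add: matrix_vector_mult_add_rdistrib scaleR_matrix_vector_assoc)

text \<open>
  The algebra spanned by the products contains the inverses of the \<open>R i\<close>: left multiplication by \<open>R i\<close>
  is an injective linear map from this finite-dimensional space to itself.
\<close>
lemma matrix_mult_span_surj:
  fixes R :: "'i \<Rightarrow> real^'d^'d"
  assumes i: "i \<in> I" and inj: "inj ((*v) (R i))" and B: "B \<in> span (matrix_monoid R I)"
  shows "\<exists>B'\<in>span (matrix_monoid R I). R i ** B' = B"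
proof -
  let ?A = "span (matrix_monoid R I)"
  obtain L where L: "L ** R i = mat 1"
    using inj matrix_left_invertible_injective by blast
  have inj': "inj (\<lambda>B :: real^'d^'d. R i ** B)"
    by (rule injI) (metis L matrix_mul_assoc matrix_mul_lid)
  have "(\<lambda>B. R i ** B) ` ?A = ?A"
  proof (rule subspace_dim_equal)
    show "subspace ((\<lambda>B. R i ** B) ` ?A)"
      by (rule linear_subspace_image[OF linear_matrix_mult_left subspace_span])
    show "dim ?A \<le> dim ((\<lambda>B. R i ** B) ` ?A)"
      using dim_image_eq[OF linear_matrix_mult_left, of "R i" ?A] inj'
      by (simp add: inj_on_def)
  qed (use i in \<open>auto intro: matrix_mult_span_closed\<close>)
  then show ?thesis using B by (metis imageE)
qed

text \<open>
  The condition of \<open>expanding\<close> for real matrices: the linear algebra below takes place in the real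
  span of products of integer matrices.
\<close>
definition expanding_matrix :: "real^'d^'d \<Rightarrow> bool" where
  "expanding_matrix A \<longleftrightarrow>
     (\<forall>l v. v \<noteq> 0 \<and> map_matrix complex_of_real A *v v = l *s v \<longrightarrow> cmod l > 1)"

lemma inj_expanding_matrix:
  fixes A :: "real^'d^'d"
  assumes "expanding_matrix A"
  shows "inj ((*v) A)"
proof (subst vec.inj_iff_eq_0, intro allI impI)
  fix x assume x: "A *v x = 0"
  define z where "z = (\<chi> a. complex_of_real (x $ a))"
  have "map_matrix complex_of_real A *v z = 0 *s z"
    using x by (simp add: z_def matrix_vector_mult_def map_matrix_def vec_eq_iff
          flip: of_real_mult of_real_sum)
  then have "z = 0"
    using assms unfolding expanding_matrix_def by (metis norm_zero not_one_less_zero)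
  then show "x = 0" by (simp add: z_def vec_eq_iff)
qed

lemma surj_expanding_matrix:
  fixes A :: "real^'d^'d"
  shows "expanding_matrix A \<Longrightarrow> surj ((*v) A)"
  by (intro vec.linear_inj_imp_surj inj_expanding_matrix matrix_vector_mul_linear_gen)

text \<open>
  The columns of the matrices are backward orbits of complex vectors.
\<close>
lemma inverse_orbit_tendsto_0:
  fixes R :: "'i \<Rightarrow> real^'d^'d" and B :: "nat \<Rightarrow> real^'d^'d"
  assumes I: "finite I" "\<And>m. b m \<in> I"
    and comm: "\<And>i j. i \<in> I \<Longrightarrow> j \<in> I \<Longrightarrow> R i ** R j = R j ** R i"
    and exp: "\<And>i. i \<in> I \<Longrightarrow> expanding_matrix (R i)"
    and B: "\<And>m. R (b m) ** B (Suc m) = B m"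
  shows "B \<longlonglongrightarrow> 0"
proof -
  define C where "C i = map_matrix complex_of_real (R i)" for i
  have "(\<lambda>m. B m $ k $ j) \<longlonglongrightarrow> 0" for k j
  proof -
    define y where "y m = (\<chi> a. complex_of_real (B m $ a $ j))" for m
    have "y \<longlonglongrightarrow> 0"
    proof (rule backward_orbit_tendsto_0[of I b C])
      show "C i ** C l = C l ** C i" if "i \<in> I" "l \<in> I" for i l
        using comm[OF that]
        by (simp add: C_def matrix_matrix_mult_def map_matrix_def vec_eq_iff flip: of_real_mult of_real_sum)
      show "C (b m) *v y (Suc m) = y m" for m
        using B[of m]
        by (simp add: C_def y_def matrix_matrix_mult_def matrix_vector_mult_def map_matrix_def vec_eq_iff
              flip: of_real_mult of_real_sum)
    qed (use I exp in \<open>auto simp: C_def expanding_matrix_def\<close>)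
    then have "(\<lambda>m. y m $ k) \<longlonglongrightarrow> 0" using tendsto_vec_nth by fastforce
    then have "(\<lambda>m. complex_of_real (B m $ k $ j)) \<longlonglongrightarrow> of_real 0" by (simp add: y_def)
    then show ?thesis by (simp only: tendsto_of_real_iff)
  qed
  then show ?thesis
    by (intro vec_tendstoI) simp
qed

definition small_part :: "real \<Rightarrow> real" where
  "small_part x = x - of_int (round x)"

lemma small_part_int: "x - small_part x \<in> \<int>"
  by (simp add: small_part_def)

lemma Ints_small_eq_0:
  fixes x :: real
  assumes "x \<in> \<int>" "\<bar>x\<bar> < 1"
  shows "x = 0"
  using assms by (auto elim!: Ints_cases)

lemma ex_dual_functionals:
  fixes V :: "'a::euclidean_space set"
  assumes "independent V"
  shows "\<exists>X :: 'a \<Rightarrow> 'a \<Rightarrow> real. (\<forall>v. linear (X v)) \<and>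
           (\<forall>v\<in>V. \<forall>w\<in>V. X v w = (if v = w then 1 else 0))"
proof -
  have "\<exists>f :: 'a \<Rightarrow> real. linear f \<and> (\<forall>w\<in>V. f w = (if v = w then 1 else 0))" for v
    using linear_independent_extend[OF assms, of "\<lambda>w. if v = w then 1 else 0"] by auto
  then obtain X :: "'a \<Rightarrow> 'a \<Rightarrow> real"
    where "\<forall>v. linear (X v) \<and> (\<forall>w\<in>V. X v w = (if v = w then 1 else 0))"
    using choice[of "\<lambda>v f. linear f \<and> (\<forall>w\<in>V. f w = (if v = w then 1 else 0))"] by auto
  then show ?thesis by (intro exI[of _ X]) auto
qed

lemma expand_dual_functionals:
  fixes V :: "'a::euclidean_space set"
  assumes V: "finite V"
    and X: "\<And>v. linear (X v :: 'a \<Rightarrow> real)" "\<And>v w. v \<in> V \<Longrightarrow> w \<in> V \<Longrightarrow> X v w = (if v = w then 1 else 0)"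
    and x: "x \<in> span V"
  shows "(\<Sum>v\<in>V. X v x *\<^sub>R v) = x"
proof -
  obtain c where c: "x = (\<Sum>v\<in>V. c v *\<^sub>R v)"
    using x(1) V(1) by (auto simp: span_finite)
  have "X w x = c w" if "w \<in> V" for w
  proof -
    have "X w x = (\<Sum>v\<in>V. c v * X w v)"
      by (simp add: c linear_sum[OF X(1)] linear_scale[OF X(1)])
    also have "\<dots> = (\<Sum>v\<in>V. if w = v then c v else 0)"
      using X(2)[OF that] by (intro sum.cong) auto
    finally show ?thesis using V that by simp
  qed
  then show ?thesis by (simp add: c cong: sum.cong)
qed

lemma matrix_monoid_int:
  assumes "\<And>i a b. i \<in> I \<Longrightarrow> R i $ a $ b \<in> \<int>" "B \<in> matrix_monoid R I"
  shows "B $ a $ b \<in> \<int>"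
  using assms(2)
  by (induction arbitrary: a b) (auto simp: mat_def matrix_matrix_mult_def assms(1) intro!: Ints_sum Ints_mult)

lemma ex_monoid_basis:
  fixes R :: "'i \<Rightarrow> real^'d^'d"
  shows "\<exists>V. finite V \<and> mat 1 \<in> V \<and> V \<subseteq> matrix_monoid R I \<and> independent V \<and>
           span (matrix_monoid R I) = span V"
proof -
  have "mat 1 \<noteq> (0 :: real^'d^'d)"
    by (auto simp: vec_eq_iff mat_def)
  then have "independent {mat 1 :: real^'d^'d}" by simp
  then obtain V where V: "{mat 1} \<subseteq> V" "V \<subseteq> matrix_monoid R I" "independent V"
      "matrix_monoid R I \<subseteq> span V"
    using maximal_independent_subset_extend[of "{mat 1}" "matrix_monoid R I"] matrix_monoid.one
    by blast
  have "span (matrix_monoid R I) = span V"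
    using V by (meson span_minimal span_mono subspace_span subset_antisym)
  then show ?thesis
    using V(1-3) independent_imp_finite[OF V(3)] by (intro exI[of _ V]) simp
qed

text \<open>
  For \<open>V\<close> take a basis of the span of all products that consists of products and contains the
  identity, and let \<open>u m v\<close> be the signed distance of \<open>\<xi> m \<bullet> (v *v t)\<close> to the nearest integer.
  The numbers \<open>\<xi> (m + 1) \<bullet> (v *v t)\<close> are rational linear combinations of the
  \<open>\<xi> m \<bullet> (w *v t)\<close>. After clearing denominators the same relation holds between the \<open>u\<close> up to an
  integer, which is less than \<open>1\<close> in modulus, hence zero, when \<open>\<delta>\<close> is small. So the \<open>u m\<close>
  define linear functionals \<open>l m\<close> with \<open>l (m + 1) B = l m (R (b m) ** B)\<close> on the span. Evaluating
  them on the inverses \<open>B m\<close> of the products \<open>R (b 0) ** \<dots> ** R (b (m - 1))\<close> gives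
  \<open>l 0 (mat 1) = l m (B m)\<close>, which tends to \<open>0\<close>, as \<open>B m\<close> tends to \<open>0\<close> while the \<open>l m\<close> are
  uniformly bounded. So \<open>u 0 (mat 1) = 0\<close>.
\<close>
lemma integer_of_small_orbit:
  fixes R :: "'i \<Rightarrow> real^'d^'d"
  assumes I: "finite I"
    and int: "\<And>i a b. i \<in> I \<Longrightarrow> R i $ a $ b \<in> \<int>"
    and comm: "\<And>i j. i \<in> I \<Longrightarrow> j \<in> I \<Longrightarrow> R i ** R j = R j ** R i"
    and exp: "\<And>i. i \<in> I \<Longrightarrow> expanding_matrix (R i)"
  shows "\<exists>V \<delta>. finite V \<and> V \<subseteq> matrix_monoid R I \<and> \<delta> > 0 \<and>
    (\<forall>\<xi> b t. (\<forall>m. b m \<in> I) \<and> (\<forall>m. \<xi> (Suc m) = \<xi> m v* R (b m)) \<and>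
       (\<forall>m. \<forall>v\<in>V. \<bar>small_part (\<xi> m \<bullet> (v *v t))\<bar> < \<delta>) \<longrightarrow> \<xi> 0 \<bullet> t \<in> \<int>)"
proof -
  obtain V where V: "finite V" "mat 1 \<in> V" "V \<subseteq> matrix_monoid R I" "independent V"
     "span (matrix_monoid R I) = span V"
    using ex_monoid_basis[of R I] by blast
  obtain X :: "real^'d^'d \<Rightarrow> real^'d^'d \<Rightarrow> real" where X: "\<And>v. linear (X v)"
      "\<And>v w. v \<in> V \<Longrightarrow> w \<in> V \<Longrightarrow> X v w = (if v = w then 1 else 0)"
    using ex_dual_functionals[OF V(4)] by blast
  note expand = expand_dual_functionals[OF V(1) X]
  define c where "c i v w = X w (R i ** v)" for i v w
  have Rv: "R i ** v \<in> matrix_monoid R I" if "i \<in> I" "v \<in> V" for i v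
    using that V(3) by (auto intro: matrix_monoid.step)
  have entry: "B \<bullet> e \<in> \<rat>" if "B \<in> matrix_monoid R I" "e \<in> Basis" for B e
  proof -
    have "B \<bullet> e \<in> \<int>"
      using that(2) matrix_monoid_int[OF int that(1)]
      by (auto simp: Basis_vec_def inner_axis)
    then show ?thesis using Ints_subset_Rats by blast
  qed
  have "c i v w \<in> \<rat>" if "i \<in> I" "v \<in> V" "w \<in> V" for i v w
    unfolding c_def
  proof (rule rational_coordinates[OF V(1,4) X])
    show "R i ** v \<in> span V"
      using Rv[OF that(1,2)] V(5) span_base by blast
  qed (use that Rv entry V(3) in auto)
  then have "\<exists>q::nat. q > 0 \<and> (\<forall>(i,v,w)\<in>I \<times> V \<times> V. real q * c i v w \<in> \<int>)"
    using common_denominator[of "I \<times> V \<times> V" "\<lambda>(i,v,w). c i v w"] I V(1)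
    by (auto simp: case_prod_unfold)
  then obtain q :: nat where q: "q > 0" "\<And>i v w. i \<in> I \<Longrightarrow> v \<in> V \<Longrightarrow> w \<in> V \<Longrightarrow> real q * c i v w \<in> \<int>"
    by auto
  (* With the bound inverse K on the small parts, the integer in question is less than 1 in modulus. *)
  define K where "K = real q + (\<Sum>(i,v,w)\<in>I \<times> V \<times> V. \<bar>real q * c i v w\<bar>)"
  have K: "K \<ge> real q + (\<Sum>w\<in>V. \<bar>real q * c i v w\<bar>)" if "i \<in> I" "v \<in> V" for i v
  proof -
    have "(\<Sum>w\<in>V. \<bar>real q * c i v w\<bar>) = (\<Sum>(i,v,w)\<in>{i} \<times> {v} \<times> V. \<bar>real q * c i v w\<bar>)"
      by (simp add: sum.cartesian_product[symmetric])
    also have "\<dots> \<le> (\<Sum>(i,v,w)\<in>I \<times> V \<times> V. \<bar>real q * c i v w\<bar>)"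
      using that I V(1) by (intro sum_mono2) auto
    finally show ?thesis by (simp add: K_def)
  qed
  have Kpos: "K > 0" using q by (auto simp: K_def intro!: add_pos_nonneg sum_nonneg)
  have inj: "inj ((*v) (R i))" if "i \<in> I" for i
    using inj_expanding_matrix[OF exp[OF that]] .
  have main: "\<xi> 0 \<bullet> t \<in> \<int>"
    if b: "\<And>m. b m \<in> I" and \<xi>: "\<And>m. \<xi> (Suc m) = \<xi> m v* R (b m)"
      and small: "\<And>m v. v \<in> V \<Longrightarrow> \<bar>small_part (\<xi> m \<bullet> (v *v t))\<bar> < inverse K" for \<xi> b t
  proof -
    define u where "u m v = small_part (\<xi> m \<bullet> (v *v t))" for m v
    have rec: "u (Suc m) v = (\<Sum>w\<in>V. c (b m) v w * u m w)" if v: "v \<in> V" for m v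
    proof -
      let ?i = "b m"
      have "R ?i ** v = (\<Sum>w\<in>V. c ?i v w *\<^sub>R w)"
        using expand[of "R ?i ** v"] Rv[OF b v] V(5) span_base unfolding c_def by metis
      then have "(R ?i ** v) *v t = (\<Sum>w\<in>V. c ?i v w *\<^sub>R (w *v t))"
        by (simp add: linear_sum[OF linear_matrix_vector_left] scaleR_matrix_vector_assoc)
      then have "\<xi> (Suc m) \<bullet> (v *v t) = (\<Sum>w\<in>V. c ?i v w * (\<xi> m \<bullet> (w *v t)))"
        by (simp add: \<xi> dot_lmul_matrix matrix_vector_mul_assoc inner_sum_right)
      then have "real q * u (Suc m) v - (\<Sum>w\<in>V. real q * c ?i v w * u m w) =
          (\<Sum>w\<in>V. real q * c ?i v w * (\<xi> m \<bullet> (w *v t) - u m w)) -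
          real q * (\<xi> (Suc m) \<bullet> (v *v t) - u (Suc m) v)"
        by (simp add: algebra_simps sum_distrib_left sum_subtractf)
      also have "\<dots> \<in> \<int>"
        unfolding u_def
        by (intro Ints_diff Ints_sum Ints_mult[OF _ small_part_int] q(2)[OF b v] Ints_of_nat)
      finally have "real q * u (Suc m) v - (\<Sum>w\<in>V. real q * c ?i v w * u m w) \<in> \<int>" .
      moreover have "\<bar>real q * u (Suc m) v - (\<Sum>w\<in>V. real q * c ?i v w * u m w)\<bar> < 1"
      proof -
        have "\<bar>real q * u (Suc m) v - (\<Sum>w\<in>V. real q * c ?i v w * u m w)\<bar> \<le>
           real q * \<bar>u (Suc m) v\<bar> + (\<Sum>w\<in>V. \<bar>real q * c ?i v w\<bar> * \<bar>u m w\<bar>)"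
          by (rule order.trans[OF abs_triangle_ineq4], intro add_mono order.trans[OF sum_abs])
             (auto simp: abs_mult)
        also have "\<dots> < real q * inverse K + (\<Sum>w\<in>V. \<bar>real q * c ?i v w\<bar> * inverse K)"
          using small v q by (intro add_less_le_mono sum_mono mult_left_mono mult_strict_left_mono)
             (auto simp: u_def less_imp_le)
        also have "\<dots> = (real q + (\<Sum>w\<in>V. \<bar>real q * c ?i v w\<bar>)) * inverse K"
          by (simp add: algebra_simps sum_distrib_left)
        also have "\<dots> \<le> K * inverse K"
          using K[OF b v] Kpos by (intro mult_right_mono) auto
        also have "\<dots> = 1" using Kpos by simp
        finally show ?thesis .
      qed
      ultimately have "real q * u (Suc m) v = (\<Sum>w\<in>V. real q * c ?i v w * u m w)"
        using Ints_small_eq_0 by fastforce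
      also have "\<dots> = real q * (\<Sum>w\<in>V. c ?i v w * u m w)"
        by (simp add: sum_distrib_left mult.assoc)
      finally show ?thesis using q by simp
    qed
    define l where "l m B = (\<Sum>v\<in>V. X v B * u m v)" for m B
    have lin: "linear (l m)" for m
      by (rule linearI)
        (simp_all add: l_def linear_add[OF X(1)] linear_scale[OF X(1)] algebra_simps
          sum.distrib sum_distrib_left)
    have l_V: "l m v = u m v" if "v \<in> V" for m v
    proof -
      have "l m v = (\<Sum>w\<in>V. if w = v then u m w else 0)"
        unfolding l_def using X(2)[OF _ that] by (intro sum.cong) auto
      then show ?thesis using V(1) that by simp
    qed
    have step: "l m (R (b m) ** B) = l (Suc m) B" if "B \<in> span V" for m B
    proof (rule linear_eq_on_span[OF _ _ _ that])
      show "linear (\<lambda>B. l m (R (b m) ** B))"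
        using linear_compose[OF linear_matrix_mult_left lin] by (simp add: o_def)
      show "l m (R (b m) ** v) = l (Suc m) v" if "v \<in> V" for v
        unfolding l_V[OF that] rec[OF that] by (simp add: l_def c_def)
    qed (rule lin)
    (* The inverses of the products along the path, as elements of the spanned algebra. *)
    have "\<exists>B. B 0 = mat 1 \<and> (\<forall>m. B m \<in> span V \<and> R (b m) ** B (Suc m) = B m)"
    proof -
      define f where "f m B = (SOME B'. B' \<in> span V \<and> R (b m) ** B' = B)" for m B
      have "\<exists>B'. B' \<in> span V \<and> R (b m) ** B' = B" if "B \<in> span V" for B m
        using matrix_mult_span_surj[of "b m" I R B] b inj[OF b] that V(5) by auto
      then have f: "f m B \<in> span V \<and> R (b m) ** f m B = B" if "B \<in> span V" for m B
        unfolding f_def using that by (intro someI_ex[of "\<lambda>B'. B' \<in> span V \<and> R (b m) ** B' = B"]) auto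
      define B where "B = rec_nat (mat 1) f"
      have "B m \<in> span V" for m
        by (induction m) (use V(2) f in \<open>simp_all add: B_def span_base\<close>)
      then show ?thesis
        using f by (intro exI[of _ B]) (simp add: B_def)
    qed
    then obtain B where B: "B 0 = mat 1" "\<And>m. B m \<in> span V" "\<And>m. R (b m) ** B (Suc m) = B m"
      by blast
    have "l m (B m) = l 0 (mat 1)" for m
    proof (induction m)
      case (Suc m)
      then show ?case using step[OF B(2), of m "Suc m"] B(3)[of m] by simp
    qed (simp add: B)
    moreover have "(\<lambda>m. l m (B m)) \<longlonglongrightarrow> 0"
    proof -
      have "B \<longlonglongrightarrow> 0"
        using inverse_orbit_tendsto_0[of I b R B] I b comm exp B(3) by auto
      then have XB: "(\<lambda>m. X v (B m)) \<longlonglongrightarrow> 0" for v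
        using bounded_linear.tendsto_zero[of "X v" B sequentially] X(1)[of v]
        by (simp add: linear_conv_bounded_linear)
      have "(\<lambda>m. X v (B m) * u m v) \<longlonglongrightarrow> 0" if "v \<in> V" for v
      proof (rule Lim_null_comparison)
        have "norm (X v (B m) * u m v) \<le> \<bar>X v (B m)\<bar> * inverse K" for m
          using small[OF that, of m] unfolding u_def real_norm_def abs_mult
          by (intro mult_left_mono) simp_all
        then show "\<forall>\<^sub>F m in sequentially. norm (X v (B m) * u m v) \<le> \<bar>X v (B m)\<bar> * inverse K"
          by (intro always_eventually allI)
        show "(\<lambda>m. \<bar>X v (B m)\<bar> * inverse K) \<longlonglongrightarrow> 0"
          using XB by (intro tendsto_mult_left_zero tendsto_rabs_zero)
      qed
      then show ?thesis unfolding l_def by (rule tendsto_null_sum)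
    qed
    ultimately have "l 0 (mat 1) = 0" by (simp add: LIMSEQ_const_iff)
    then have "u 0 (mat 1) = 0" using l_V V(2) by simp
    then show ?thesis
      using small_part_int[of "\<xi> 0 \<bullet> t"] by (simp add: u_def)
  qed
  show ?thesis
  proof (intro exI conjI allI impI)
    show "inverse K > 0" using Kpos by simp
    show "\<xi> 0 \<bullet> t \<in> \<int>"
      if "(\<forall>m. b m \<in> I) \<and> (\<forall>m. \<xi> (Suc m) = \<xi> m v* R (b m)) \<and>
        (\<forall>m. \<forall>v\<in>V. \<bar>small_part (\<xi> m \<bullet> (v *v t))\<bar> < inverse K)" for \<xi> b t
      using that by (intro main[of b \<xi> t]) simp_all
  qed (rule V(1) V(3))+
qed

section \<open>Characters of the torus and uniqueness of Fourier coefficients\<close>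

lemma continuous_on_torusI:
  fixes f :: "'d::finite torus \<Rightarrow> 'a::topological_space"
  assumes "continuous_on UNIV (\<lambda>x. f (to_torus x))"
  shows "continuous_on UNIV f"
proof (subst continuous_on_open_vimage, simp, intro allI impI)
  fix U :: "'a set" assume "open U"
  then have "open ((\<lambda>x. f (to_torus x)) -` U)"
    using assms by (simp add: continuous_on_open_vimage)
  then show "open (f -` U \<inter> UNIV)"
    by (simp add: open_torus_def vimage_def)
qed

lemma compact_torus: "compact (UNIV :: 'd::finite torus set)"
proof -
  have "\<exists>x. x \<in> cbox 0 (1 :: real^'d) \<and> to_torus x = t" for t
  proof -
    obtain y where y: "t = to_torus y" by (rule to_torus_cases)
    obtain k where k: "int_vec k" "y - k \<in> unit_cube"
      using ex1_int_vec_unit_cube[of y] by blast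
    then have "to_torus (y - k) = t"
      by (simp add: y to_torus_eq_iff int_vec_uminus)
    moreover have "y - k \<in> cbox 0 1"
      using k(2) by (auto simp: unit_cube_def mem_box_cart less_imp_le)
    ultimately show ?thesis by blast
  qed
  then have "UNIV = to_torus ` cbox 0 (1 :: real^'d)" by (metis UNIV_eq_I image_eqI)
  moreover have "compact (to_torus ` cbox 0 (1 :: real^'d))"
    by (intro compact_continuous_image continuous_on_subset[OF continuous_on_to_torus]) auto
  ultimately show ?thesis by simp
qed

text \<open>
  The value at an arbitrary representative, which depends on the choice unless \<open>k\<close> is an integer
  vector. Real vectors \<open>k\<close> are admitted so that \<open>k v* R\<close> makes sense for real matrices.
\<close>
definition character :: "real^'d \<Rightarrow> 'd::finite torus \<Rightarrow> complex" where
  "character k t = cis (2 * pi * (k \<bullet> inv to_torus t))"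

lemma cis_2pi_eq_1_iff: "cis (2 * pi * x) = 1 \<longleftrightarrow> x \<in> \<int>"
proof -
  have "cis (2 * pi * x) = 1 \<longleftrightarrow> cos (2 * pi * x) = 1"
    by (auto simp: complex_eq_iff cos_one_sin_zero)
  also have "\<dots> \<longleftrightarrow> x \<in> \<int>"
    by (auto simp: cos_one_2pi_int Ints_def)
  finally show ?thesis .
qed

lemma int_vec_inner: "int_vec k \<Longrightarrow> int_vec x \<Longrightarrow> k \<bullet> x \<in> \<int>"
  by (auto simp: int_vec_def inner_vec_def intro!: Ints_sum Ints_mult)

lemma character_to_torus:
  assumes "int_vec k"
  shows "character k (to_torus x) = cis (2 * pi * (k \<bullet> x))"
proof -
  let ?y = "inv to_torus (to_torus x)"
  have "to_torus ?y = to_torus x"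
    by (rule surj_f_inv_f[OF surj_to_torus])
  then have "k \<bullet> (?y - x) \<in> \<int>"
    using assms by (simp add: to_torus_eq_iff int_vec_inner)
  then have "cis (2 * pi * (k \<bullet> (?y - x))) = 1"
    by (simp add: cis_2pi_eq_1_iff)
  moreover have "2 * pi * (k \<bullet> ?y) = 2 * pi * (k \<bullet> (?y - x)) + 2 * pi * (k \<bullet> x)"
    by (simp add: inner_diff_right algebra_simps)
  ultimately show ?thesis
    unfolding character_def by (simp add: cis_mult[symmetric])
qed

lemma norm_character [simp]: "norm (character k t) = 1"
  by (simp add: character_def)

lemma character_0 [simp]: "character 0 = (\<lambda>_. 1)"
  by (simp add: character_def fun_eq_iff)

lemma character_mult: "character k t * character l t = character (k + l) t"
  by (simp add: character_def cis_mult inner_add_left distrib_left)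

lemma character_uminus: "character (- k) t = cnj (character k t)"
  by (simp add: character_def cis_cnj)

lemma character_add:
  assumes "int_vec k"
  shows "character k (s + t) = character k s * character k t"
proof -
  obtain x y where "s = to_torus x" "t = to_torus y" by (metis to_torus_cases)
  then show ?thesis
    by (simp add: character_to_torus[OF assms] cis_mult inner_add_right distrib_left flip: to_torus_add)
qed

lemma character_torus_uminus:
  assumes "int_vec k"
  shows "character k (- t) = cnj (character k t)"
proof -
  obtain x where "t = to_torus x" by (rule to_torus_cases)
  then show ?thesis
    by (simp add: character_to_torus[OF assms] cis_cnj flip: to_torus_uminus)
qed

lemma ex_character_eq_minus_1:
  assumes "int_vec k" "k \<noteq> 0"
  shows "\<exists>a. character k a = -1"
  using assms by (intro exI[of _ "to_torus ((1 / (2 * (k \<bullet> k))) *\<^sub>R k)"]) (simp add: character_to_torus)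

lemma continuous_on_character:
  assumes "int_vec k"
  shows "continuous_on UNIV (character k)"
  by (rule continuous_on_torusI) (auto simp: character_to_torus[OF assms] intro!: continuous_intros)

lemma closed_kernel_character:
  assumes "int_vec k"
  shows "closed {t. character k t = 1}"
  using closed_vimage[of "{1}" "character k"] continuous_on_character[OF assms]
  by (simp add: vimage_def)

lemma add_subgroup_kernel_character:
  assumes "int_vec k"
  shows "add_subgroup {t. character k t = 1}"
  using character_to_torus[OF assms, of 0]
  by (auto simp: add_subgroup_def character_add[OF assms] character_torus_uminus[OF assms] to_torus_0)

lemma measurable_character [measurable]:
  assumes "int_vec k"
  shows "character k \<in> borel_measurable borel"
  by (rule borel_measurable_continuous_onI[OF continuous_on_character[OF assms]])

lemma int_vec_axis: "int_vec (axis i 1)"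
  by (auto simp: int_vec_def axis_def)

lemma characters_separate_points:
  assumes "s \<noteq> (t :: 'd::finite torus)"
  obtains k where "int_vec k" "character k s \<noteq> character k t"
proof -
  obtain x y where xy: "s = to_torus x" "t = to_torus y" by (metis to_torus_cases)
  then obtain i where i: "x $ i - y $ i \<notin> \<int>"
    using assms by (auto simp: to_torus_eq_iff int_vec_def)
  have "character (axis i 1) s \<noteq> character (axis i 1) t"
  proof
    assume "character (axis i 1) s = character (axis i 1) t"
    then have "cis (2 * pi * (x $ i)) / cis (2 * pi * (y $ i)) = 1"
      by (simp add: xy character_to_torus int_vec_axis inner_axis')
    then have "cis (2 * pi * (x $ i - y $ i)) = 1"
      by (simp add: cis_divide right_diff_distrib)
    then show False using i by (simp add: cis_2pi_eq_1_iff)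
  qed
  then show thesis using that int_vec_axis by blast
qed

instance torus :: (finite) t2_space
proof
  fix s t :: "'a torus" assume "s \<noteq> t"
  then obtain k where k: "int_vec k" "character k s \<noteq> character k t"
    by (rule characters_separate_points)
  then obtain U V where UV: "open U" "open V" "character k s \<in> U" "character k t \<in> V" "U \<inter> V = {}"
    using hausdorff[of "character k s" "character k t"] by blast
  have "open (character k -` U)" "open (character k -` V)"
    using continuous_on_character[OF k(1)] UV by (auto simp: continuous_on_open_vimage)
  then show "\<exists>U V. open U \<and> open V \<and> s \<in> U \<and> t \<in> V \<and> U \<inter> V = {}"
    using UV by (intro exI[of _ "character k -` U"] exI[of _ "character k -` V"]) auto
qed

text \<open>
  Closed under multiplication as well (\<open>trig_polys_mult\<close>), because a product of two characters is a
  character.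
\<close>
inductive_set trig_polys :: "('d::finite torus \<Rightarrow> complex) set" where
  mono: "int_vec k \<Longrightarrow> (\<lambda>t. c * character k t) \<in> trig_polys"
| add: "f \<in> trig_polys \<Longrightarrow> g \<in> trig_polys \<Longrightarrow> (\<lambda>t. f t + g t) \<in> trig_polys"

lemma trig_polys_term_mult:
  assumes k: "int_vec k" and g: "g \<in> trig_polys"
  shows "(\<lambda>t. c * character k t * g t) \<in> trig_polys"
  using g
proof induction
  case (mono l d)
  have "(\<lambda>t. (c * d) * character (k + l) t) \<in> trig_polys"
    using k mono by (intro trig_polys.mono int_vec_add)
  then show ?case by (simp add: mult_ac flip: character_mult)
next
  case (add f g)
  then show ?case using trig_polys.add[OF add.IH] by (simp add: algebra_simps)
qed

lemma trig_polys_mult: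
  assumes "f \<in> trig_polys" and g: "g \<in> trig_polys"
  shows "(\<lambda>t. f t * g t) \<in> trig_polys"
  using assms(1)
proof induction
  case (mono k c)
  then show ?case using g by (rule trig_polys_term_mult)
next
  case (add f f')
  then show ?case using trig_polys.add[OF add.IH] by (simp add: algebra_simps)
qed

lemma trig_polys_continuous: "f \<in> trig_polys \<Longrightarrow> continuous_on UNIV f"
  by (induction rule: trig_polys.induct) (auto intro!: continuous_intros continuous_on_character)

text \<open>
  Stone-Weierstrass for the real-valued trigonometric polynomials; they separate points because the
  real and imaginary parts of the characters are among them.
\<close>
lemma trig_polys_approx:
  fixes f :: "'d::finite torus \<Rightarrow> real"
  assumes f: "continuous_on UNIV f" and e: "e > 0"
  obtains g where "(\<lambda>t. complex_of_real (g t)) \<in> trig_polys" "\<And>t. \<bar>f t - g t\<bar> < e"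
proof -
  define P where "P g \<longleftrightarrow> (\<lambda>t. complex_of_real (g t)) \<in> trig_polys" for g :: "'d torus \<Rightarrow> real"
  have "\<exists>g. P g \<and> (\<forall>t\<in>UNIV. \<bar>f t - g t\<bar> < e)"
  proof (rule Stone_Weierstrass_HOL[OF compact_torus _ _ _ _ _ f e])
    show "P (\<lambda>x. c)" for c
      using trig_polys.mono[of 0 "complex_of_real c"] by (simp add: P_def)
    show "continuous_on UNIV g" if "P g" for g
    proof -
      have "continuous_on UNIV (\<lambda>t. Re (complex_of_real (g t)))"
        using trig_polys_continuous that unfolding P_def by (intro continuous_on_Re)
      then show ?thesis by simp
    qed
    show "P (\<lambda>t. g t + h t)" if "P g \<and> P h" for g h
      using that trig_polys.add by (fastforce simp: P_def)
    show "P (\<lambda>t. g t * h t)" if "P g \<and> P h" for g h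
      using that trig_polys_mult by (fastforce simp: P_def)
    fix s t :: "'d torus" assume "s \<in> UNIV \<and> t \<in> UNIV \<and> s \<noteq> t"
    then obtain k where k: "int_vec k" "character k s \<noteq> character k t"
      using characters_separate_points by blast
    have lin: "(\<lambda>t. a * character k t + b * character (- k) t) \<in> trig_polys" for a b
      using k by (intro trig_polys.intros int_vec_uminus)
    have "P (\<lambda>t. Re (character k t))"
      using lin[of "1/2" "1/2"] unfolding P_def character_uminus
      by (rule back_subst[of "\<lambda>f. f \<in> trig_polys"]) (auto simp: complex_eq_iff)
    moreover have "P (\<lambda>t. Im (character k t))"
      using lin[of "- \<i>/2" "\<i>/2"] unfolding P_def character_uminus
      by (rule back_subst[of "\<lambda>f. f \<in> trig_polys"]) (auto simp: complex_eq_iff)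
    ultimately show "\<exists>f. P f \<and> f s \<noteq> f t"
      using k(2) by (auto simp: complex_eq_iff)
  qed
  then show thesis using that unfolding P_def by blast
qed

lemma integrable_continuous_torus:
  fixes f :: "'d::finite torus \<Rightarrow> 'b::{banach, second_countable_topology}"
  assumes "prob_space \<nu>" "sets \<nu> = sets borel" and f: "continuous_on UNIV f"
  shows "integrable \<nu> f"
proof -
  interpret prob_space \<nu> by fact
  have "bounded (range f)"
    using compact_continuous_image[OF f compact_torus] by (rule compact_imp_bounded)
  then obtain B where "\<And>t. norm (f t) \<le> B" by (auto simp: bounded_iff)
  moreover have "f \<in> borel_measurable \<nu>"
    using borel_measurable_continuous_onI[OF f] assms(2) by (simp cong: measurable_cong_sets)
  ultimately show ?thesis by (intro integrable_const_bound[of _ B]) auto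
qed

text \<open>
  The functions \<open>max 0 (1 - n * d)\<close> decrease to the indicator, where \<open>d\<close> is the distance to the
  preimage of \<open>F\<close> in \<open>real^'d\<close>. This distance is periodic, so it descends to the torus.
\<close>
lemma closed_torus_bump:
  fixes F :: "'d::finite torus set"
  assumes F: "closed F" "F \<noteq> {}"
  obtains f :: "nat \<Rightarrow> 'd torus \<Rightarrow> real" where
    "\<And>n. continuous_on UNIV (f n)" "\<And>n t. \<bar>f n t\<bar> \<le> 1" "\<And>t. (\<lambda>n. f n t) \<longlonglongrightarrow> indicator F t"
proof -
  define E where "E = to_torus -` F"
  have "closed E"
    using F(1) continuous_on_to_torus unfolding E_def by (metis closed_vimage)
  have "E \<noteq> {}"
    using F(2) surj_to_torus unfolding E_def by (metis surj_image_vimage_eq image_empty)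
  have le: "infdist x E \<le> infdist y E" if "int_vec (x - y)" for x y
  proof -
    have "infdist x E \<le> dist y a" if a: "a \<in> E" for a
    proof -
      have "to_torus (a + (x - y)) = to_torus a"
        using \<open>int_vec (x - y)\<close> by (simp add: to_torus_eq_iff)
      then have "a + (x - y) \<in> E" using a by (simp add: E_def)
      then have "infdist x E \<le> dist x (a + (x - y))" by (rule infdist_le)
      then show ?thesis by (simp add: dist_norm algebra_simps)
    qed
    then show ?thesis
      using \<open>E \<noteq> {}\<close> unfolding infdist_notempty[OF \<open>E \<noteq> {}\<close>, of y]
      by (intro cINF_greatest) auto
  qed
  define f where "f n t = max 0 (1 - real n * infdist (inv to_torus t) E)" for n t
  have f: "f n (to_torus x) = max 0 (1 - real n * infdist x E)" for n x
  proof -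
    let ?y = "inv to_torus (to_torus x)"
    have "to_torus ?y = to_torus x" by (rule surj_f_inv_f[OF surj_to_torus])
    then have "int_vec (?y - x)" "int_vec (x - ?y)"
      by (metis to_torus_eq_iff)+
    then have "infdist ?y E = infdist x E" using le by (metis order_antisym)
    then show ?thesis by (simp add: f_def)
  qed
  show thesis
  proof (rule that[of f])
    show "continuous_on UNIV (f n)" for n
      by (rule continuous_on_torusI) (auto simp: f intro!: continuous_intros)
    show "\<bar>f n t\<bar> \<le> 1" for n t
      by (simp add: f_def infdist_nonneg)
    fix t :: "'d torus"
    obtain x where x: "t = to_torus x" by (rule to_torus_cases)
    show "(\<lambda>n. f n t) \<longlonglongrightarrow> indicator F t"
    proof (cases "t \<in> F")
      case True
      then have "infdist x E = 0" by (simp add: E_def x)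
      then show ?thesis using True by (simp add: x f)
    next
      case False
      then have "infdist x E > 0"
        using \<open>closed E\<close> \<open>E \<noteq> {}\<close> by (simp add: E_def x infdist_pos_not_in_closed)
      then have "\<forall>\<^sub>F n in sequentially. 1 / infdist x E < real n"
        using filterlim_real_sequentially by (simp add: filterlim_at_top_dense)
      then have "\<forall>\<^sub>F n in sequentially. f n t = 0"
        by eventually_elim (use \<open>infdist x E > 0\<close> in \<open>simp add: x f field_simps\<close>)
      then show ?thesis using False by (simp add: tendsto_eventually)
    qed
  qed
qed

text \<open>
  Equality of Fourier coefficients gives equality of the integrals of trigonometric polynomials,
  then of continuous functions, then of indicators of closed sets.
\<close>
lemma torus_measure_eqI:
  fixes \<nu> \<nu>' :: "'d::finite torus measure"
  assumes prob: "prob_space \<nu>" "prob_space \<nu>'"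
    and sets: "sets \<nu> = sets borel" "sets \<nu>' = sets borel"
    and eq: "\<And>k. int_vec k \<Longrightarrow> integral\<^sup>L \<nu> (character k) = integral\<^sup>L \<nu>' (character k)"
  shows "\<nu> = \<nu>'"
proof -
  interpret N: prob_space \<nu> by fact
  interpret N': prob_space \<nu>' by fact
  note int = integrable_continuous_torus[OF prob(1) sets(1)] integrable_continuous_torus[OF prob(2) sets(2)]
  have trig: "integral\<^sup>L \<nu> f = integral\<^sup>L \<nu>' f" if "f \<in> trig_polys" for f
    using that
  proof induction
    case (mono k c)
    then show ?case using eq by simp
  next
    case (add f g)
    then show ?case
      using int[OF trig_polys_continuous[OF add.hyps(1)]] int[OF trig_polys_continuous[OF add.hyps(2)]]
      by simp
  qed
  have cont: "integral\<^sup>L \<nu> f = integral\<^sup>L \<nu>' f" if f: "continuous_on UNIV f" for f :: "'d torus \<Rightarrow> real"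
  proof -
    have "\<bar>integral\<^sup>L \<nu> f - integral\<^sup>L \<nu>' f\<bar> \<le> e" if "e > 0" for e
    proof -
      obtain g where g: "(\<lambda>t. complex_of_real (g t)) \<in> trig_polys" "\<And>t. \<bar>f t - g t\<bar> < e / 2"
        using trig_polys_approx[OF f, of "e / 2"] \<open>e > 0\<close> by auto
      have "continuous_on UNIV (\<lambda>t. Re (complex_of_real (g t)))"
        using trig_polys_continuous[OF g(1)] by (intro continuous_on_Re)
      then have cg: "continuous_on UNIV g" by simp
      have "complex_of_real (integral\<^sup>L \<nu> g) = complex_of_real (integral\<^sup>L \<nu>' g)"
        using trig[OF g(1)] by simp
      then have gg: "integral\<^sup>L \<nu> g = integral\<^sup>L \<nu>' g" by (simp only: of_real_eq_iff)
      have b: "\<bar>integral\<^sup>L M f - integral\<^sup>L M g\<bar> \<le> e / 2" if M: "prob_space M" "sets M = sets borel" for M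
      proof -
        interpret M: prob_space M by fact
        note i = integrable_continuous_torus[OF M]
        have "\<bar>integral\<^sup>L M f - integral\<^sup>L M g\<bar> = \<bar>\<integral>t. f t - g t \<partial>M\<bar>"
          using i[OF f] i[OF cg] by simp
        also have "\<dots> \<le> (\<integral>t. \<bar>f t - g t\<bar> \<partial>M)" by (rule integral_abs_bound)
        also have "\<dots> \<le> (\<integral>t. e / 2 \<partial>M)"
          using i[OF f] i[OF cg] g(2) by (intro integral_mono) (auto simp: less_imp_le)
        finally show ?thesis by (simp add: M.prob_space)
      qed
      show ?thesis
        using b[OF prob(1) sets(1)] b[OF prob(2) sets(2)] gg by linarith
    qed
    then show ?thesis
      using field_le_epsilon[of "\<bar>integral\<^sup>L \<nu> f - integral\<^sup>L \<nu>' f\<bar>" 0] by simp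
  qed
  have closed: "measure \<nu> F = measure \<nu>' F" if F: "closed F" for F
  proof (cases "F = {}")
    case False
    obtain f :: "nat \<Rightarrow> 'd torus \<Rightarrow> real" where f: "\<And>n. continuous_on UNIV (f n)"
      "\<And>n t. \<bar>f n t\<bar> \<le> 1" "\<And>t. (\<lambda>n. f n t) \<longlonglongrightarrow> indicator F t"
      using closed_torus_bump[OF F False] by blast
    have lim: "(\<lambda>n. integral\<^sup>L M (f n)) \<longlonglongrightarrow> measure M F"
      if M: "prob_space M" "sets M = sets borel" for M
    proof -
      interpret M: prob_space M by fact
      have "F \<in> sets M" using M(2) F by simp
      then have "(\<lambda>n. integral\<^sup>L M (f n)) \<longlonglongrightarrow> integral\<^sup>L M (indicator F :: 'd torus \<Rightarrow> real)"
        using f integrable_continuous_torus[OF M f(1)]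
        by (intro integral_dominated_convergence[where w = "\<lambda>_. 1"]) auto
      then show ?thesis using \<open>F \<in> sets M\<close> by (simp add: sets.Int_space_eq2)
    qed
    have "(\<lambda>n. integral\<^sup>L \<nu> (f n)) \<longlonglongrightarrow> measure \<nu>' F"
      using lim[OF prob(2) sets(2)] cont[OF f(1)] by simp
    then show ?thesis using lim[OF prob(1) sets(1)] LIMSEQ_unique by blast
  qed simp
  show ?thesis
  proof (rule measure_eqI_generator_eq[of "{U. open U}" UNIV _ _ "\<lambda>_. UNIV"])
    show "Int_stable {U :: 'd torus set. open U}" by (auto simp: Int_stable_def)
    show "sets \<nu> = sigma_sets UNIV {U. open U}" "sets \<nu>' = sigma_sets UNIV {U. open U}"
      using sets by (simp_all add: sets_borel)
    show "emeasure \<nu> U = emeasure \<nu>' U" if "U \<in> {U. open U}" for U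
    proof -
      have sp: "space \<nu> = UNIV" "space \<nu>' = UNIV"
        using sets_eq_imp_space_eq[OF sets(1)] sets_eq_imp_space_eq[OF sets(2)] by auto
      have "- U \<in> sets \<nu>" "- U \<in> sets \<nu>'" using that sets by auto
      then have "measure \<nu> U = 1 - measure \<nu> (- U)" "measure \<nu>' U = 1 - measure \<nu>' (- U)"
        using N.prob_compl[of "- U"] N'.prob_compl[of "- U"] sp by (auto simp: Compl_eq_Diff_UNIV[symmetric])
      moreover have "closed (- U)" using that by (simp add: closed_Compl)
      ultimately show ?thesis
        using closed[of "- U"] by (simp add: N.emeasure_eq_measure N'.emeasure_eq_measure)
    qed
  qed (auto simp: N.emeasure_eq_measure)
qed

section \<open>Bounded solutions of a twisted mean value equation\<close>

lemma weighted_variance: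
  fixes z :: "'g \<Rightarrow> 'a::real_inner"
  assumes "sum p G = 1" and w: "w = (\<Sum>g\<in>G. p g *\<^sub>R z g)"
  shows "(\<Sum>g\<in>G. p g * (norm (z g - w))\<^sup>2) = (\<Sum>g\<in>G. p g * (norm (z g))\<^sup>2) - (norm w)\<^sup>2"
proof -
  have "(\<Sum>g\<in>G. p g * (norm (z g - w))\<^sup>2) =
      (\<Sum>g\<in>G. p g * (norm (z g))\<^sup>2 - 2 * ((p g *\<^sub>R z g) \<bullet> w) + p g * (w \<bullet> w))"
    by (intro sum.cong)
       (simp_all add: power2_norm_eq_inner inner_diff_left inner_diff_right inner_commute algebra_simps)
  also have "\<dots> = (\<Sum>g\<in>G. p g * (norm (z g))\<^sup>2) - 2 * ((\<Sum>g\<in>G. p g *\<^sub>R z g) \<bullet> w) + sum p G * (w \<bullet> w)"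
    by (simp add: sum.distrib sum_subtractf inner_sum_left sum_distrib_left sum_distrib_right)
  also have "\<dots> = (\<Sum>g\<in>G. p g * (norm (z g))\<^sup>2) - (norm w)\<^sup>2"
    by (simp add: assms(1) power2_norm_eq_inner flip: w)
  finally show ?thesis .
qed

text \<open>
  By the variance identity the mean square deviation of the \<open>z g k\<close> from their average is at most
  \<open>S\<^sup>2 - |w k|\<^sup>2\<close>, which tends to \<open>0\<close>; every \<open>g\<close> has positive weight in this mean.
\<close>
lemma averages_near_maximum:
  fixes z :: "'g \<Rightarrow> 'k \<Rightarrow> 'a::real_inner"
  assumes G: "finite G" "sum p G = 1" "\<And>g. g \<in> G \<Longrightarrow> p g > 0"
    and w: "\<And>k. k \<in> K \<Longrightarrow> w k = (\<Sum>g\<in>G. p g *\<^sub>R z g k)"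
    and S: "\<And>g k. g \<in> G \<Longrightarrow> k \<in> K \<Longrightarrow> norm (z g k) \<le> S"
    and F: "\<forall>\<^sub>F k in F. k \<in> K" "((\<lambda>k. norm (w k)) \<longlongrightarrow> S) F"
    and g: "g \<in> G"
  shows "((\<lambda>k. z g k - w k) \<longlongrightarrow> 0) F"
proof -
  have bound: "(norm (z g k - w k))\<^sup>2 \<le> (S\<^sup>2 - (norm (w k))\<^sup>2) / p g" if k: "k \<in> K" for k
  proof -
    have "p g * (norm (z g k - w k))\<^sup>2 \<le> (\<Sum>g\<in>G. p g * (norm (z g k - w k))\<^sup>2)"
      using G g by (intro member_le_sum) (auto simp: less_imp_le)
    also have "\<dots> = (\<Sum>g\<in>G. p g * (norm (z g k))\<^sup>2) - (norm (w k))\<^sup>2"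
      by (rule weighted_variance[OF G(2) w[OF k]])
    also have "(\<Sum>g\<in>G. p g * (norm (z g k))\<^sup>2) \<le> (\<Sum>g\<in>G. p g * S\<^sup>2)"
      using S[OF _ k] G(3) by (intro sum_mono mult_left_mono power_mono) (auto simp: less_imp_le)
    also have "\<dots> = S\<^sup>2" by (simp add: G(2) flip: sum_distrib_right)
    finally show ?thesis using G(3)[OF g] by (simp add: field_simps)
  qed
  have "((\<lambda>k. (S\<^sup>2 - (norm (w k))\<^sup>2) / p g) \<longlongrightarrow> (S\<^sup>2 - S\<^sup>2) / p g) F"
    using G(3)[OF g] F(2) by (intro tendsto_intros) auto
  then have "((\<lambda>k. (S\<^sup>2 - (norm (w k))\<^sup>2) / p g) \<longlongrightarrow> 0) F" by simp
  then have "((\<lambda>k. (norm (z g k - w k))\<^sup>2) \<longlongrightarrow> 0) F"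
    by (rule Lim_null_comparison[rotated]) (use F(1) bound in \<open>auto elim: eventually_mono\<close>)
  then have "((\<lambda>k. sqrt ((norm (z g k - w k))\<^sup>2)) \<longlongrightarrow> sqrt 0) F"
    by (rule tendsto_real_sqrt)
  then show ?thesis by (simp add: tendsto_norm_zero_iff)
qed

text \<open>
  The real part of \<open>cis (2 * pi * x)\<close> is the cosine of \<open>2 * pi * \<bar>small_part x\<bar>\<close>, an angle in the
  interval from \<open>0\<close> to \<open>pi\<close>, where the cosine decreases.
\<close>
lemma small_part_less_if_cis_near_1:
  assumes "e > 0"
  obtains d where "d > 0" "\<And>x. norm (cis (2 * pi * x) - 1) < d \<Longrightarrow> \<bar>small_part x\<bar> < e"
proof -
  define r where "r = min e (1/2)"
  have r: "0 < r" "r \<le> 1/2" using assms by (auto simp: r_def)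
  define d where "d = 1 - cos (2 * pi * r)"
  have "2 * pi * r \<le> pi" using r by simp
  then have "d > 0"
    using cos_monotone_0_pi[of 0 "2 * pi * r"] r by (simp add: d_def)
  moreover have "\<bar>small_part x\<bar> < e" if x: "norm (cis (2 * pi * x) - 1) < d" for x
  proof (rule ccontr)
    assume "\<not> \<bar>small_part x\<bar> < e"
    define u where "u = \<bar>small_part x\<bar>"
    have u: "r \<le> u" "u \<le> 1/2"
      using \<open>\<not> \<bar>small_part x\<bar> < e\<close> of_int_round_abs_le[of x]
      by (auto simp: u_def r_def small_part_def abs_minus_commute)
    have "cis (2 * pi * x) = cis (2 * pi * (x - small_part x)) * cis (2 * pi * small_part x)"
      by (simp add: cis_mult algebra_simps)
    then have "cis (2 * pi * x) = cis (2 * pi * small_part x)"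
      using cis_2pi_eq_1_iff small_part_int by simp
    then have "Re (cis (2 * pi * x)) = cos (2 * pi * u)"
      using cos_abs_real[of "2 * pi * small_part x"] by (simp add: u_def abs_mult)
    also have "\<dots> \<le> cos (2 * pi * r)"
      using r u by (intro cos_monotone_0_pi_le) auto
    finally have "d \<le> \<bar>Re (cis (2 * pi * x) - 1)\<bar>" by (simp add: d_def)
    also have "\<dots> \<le> norm (cis (2 * pi * x) - 1)" by (rule abs_Re_le_cmod)
    finally show False using x by simp
  qed
  ultimately show thesis using that by blast
qed

text \<open>
  If \<open>|\<phi>|\<close> has a positive supremum \<open>S\<close> over the nonzero integer vectors, then the frequencies where
  it is nearly attained reproduce themselves under every step \<open>k \<mapsto> k v* R i\<close>, and comparing two
  steps in both orders forces \<open>k \<bullet> t i j\<close> to be nearly an integer. A path of such frequencies on which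
  \<open>|\<phi>|\<close> never decreases then contradicts \<open>integer_of_small_orbit\<close>. The filter \<open>F\<close> expresses that
  \<open>|\<phi> k|\<close> tends to \<open>S\<close>.

  The averages are indexed by the maps \<open>g\<close> in the image of \<open>h\<close> and not by the letters \<open>i\<close>, since
  different letters may give the same map.
\<close>
lemma twisted_harmonic_vanishes:
  fixes R :: "'i \<Rightarrow> real^'d^'d" and \<phi> :: "real^'d \<Rightarrow> complex"
  assumes I: "finite I"
    and int: "\<And>i a b. i \<in> I \<Longrightarrow> R i $ a $ b \<in> \<int>"
    and comm: "\<And>i j. i \<in> I \<Longrightarrow> j \<in> I \<Longrightarrow> R i ** R j = R j ** R i"
    and exp: "\<And>i. i \<in> I \<Longrightarrow> expanding_matrix (R i)"
    and nontrivial: "\<And>\<xi>. int_vec \<xi> \<Longrightarrow>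
      (\<And>i j. i \<in> I \<Longrightarrow> j \<in> I \<Longrightarrow> \<xi> \<bullet> ((mat 1 - R i) *v \<alpha> j - (mat 1 - R j) *v \<alpha> i) \<in> \<int>) \<Longrightarrow> \<xi> = 0"
    and p: "sum p (h ` I) = 1" "\<And>g. g \<in> h ` I \<Longrightarrow> p g > 0"
    and harmonic: "\<And>k. int_vec k \<Longrightarrow> \<phi> k = (\<Sum>g\<in>h ` I. p g *\<^sub>R z g k)"
    and z: "\<And>i k. i \<in> I \<Longrightarrow> int_vec k \<Longrightarrow> z (h i) k = cis (2 * pi * (k \<bullet> \<alpha> i)) * \<phi> (k v* R i)"
    and bounded: "\<And>k. norm (\<phi> k) \<le> B"
    and k0: "int_vec k0" "k0 \<noteq> 0"
  shows "\<phi> k0 = 0"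
proof (rule ccontr)
  assume neg: "\<phi> k0 \<noteq> 0"
  define K where "K = {k :: real^'d. int_vec k \<and> k \<noteq> 0}"
  define S where "S = (SUP k\<in>K. norm (\<phi> k))"
  have bdd: "bdd_above ((\<lambda>k. norm (\<phi> k)) ` K)" by (rule bdd_aboveI2[OF bounded])
  have leS: "norm (\<phi> k) \<le> S" if "k \<in> K" for k
    unfolding S_def by (rule cSUP_upper[OF that bdd])
  have "k0 \<in> K" using k0 by (simp add: K_def)
  then have S: "S > 0" using leS[of k0] neg by (auto intro: less_le_trans[of _ "norm (\<phi> k0)"])
  have KR: "k v* R i \<in> K" if i: "i \<in> I" and k: "k \<in> K" for i k
  proof -
    have "int_vec (k v* R i)"
      using k int[OF i] by (auto simp: K_def int_vec_def vector_matrix_mult_def intro!: Ints_sum Ints_mult)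
    moreover have "k v* R i \<noteq> 0"
    proof
      assume "k v* R i = 0"
      then have "k \<bullet> (R i *v x) = 0" for x by (simp flip: dot_lmul_matrix)
      moreover have "surj ((*v) (R i))"
        by (rule surj_expanding_matrix[OF exp[OF i]])
      then obtain x where "k = R i *v x" unfolding surj_def by blast
      ultimately have "k \<bullet> k = 0" by simp
      then show False using k by (simp add: K_def)
    qed
    ultimately show ?thesis by (simp add: K_def)
  qed
  have normz: "norm (z (h i) k) = norm (\<phi> (k v* R i))" if "i \<in> I" "k \<in> K" for i k
    using z[OF that(1)] that(2) by (simp add: K_def norm_mult)
  define F where "F = inf (filtercomap (\<lambda>k. norm (\<phi> k)) (nhds S)) (principal K)"
  have evF: "\<exists>e>0. \<forall>k\<in>K. norm (\<phi> k) > S - e \<longrightarrow> P k" if P: "eventually P F" for P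
  proof -
    obtain Q where Q: "eventually Q (nhds S)" "\<And>k. Q (norm (\<phi> k)) \<Longrightarrow> k \<in> K \<Longrightarrow> P k"
      using P unfolding F_def eventually_inf_principal eventually_filtercomap by blast
    obtain e where e: "e > 0" "\<And>x. dist x S < e \<Longrightarrow> Q x"
      using Q(1) unfolding eventually_nhds_metric by blast
    have "P k" if "k \<in> K" "norm (\<phi> k) > S - e" for k
      using leS[OF that(1)] that by (intro Q(2) e(2)) (auto simp: dist_real_def)
    then show ?thesis using e(1) by blast
  qed
  have F_K: "\<forall>\<^sub>F k in F. k \<in> K"
    unfolding F_def eventually_inf_principal by simp
  have F_S: "((\<lambda>k. norm (\<phi> k)) \<longlongrightarrow> S) F"
    unfolding F_def by (rule tendsto_mono[OF inf_le1 filterlim_filtercomap])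
  have lim_z: "((\<lambda>k. z (h i) k - \<phi> k) \<longlongrightarrow> 0) F" if "i \<in> I" for i
  proof (rule averages_near_maximum[OF finite_imageI[OF I] p _ _ F_K F_S])
    show "norm (z g k) \<le> S" if "g \<in> h ` I" "k \<in> K" for g k
      using that leS[OF KR] normz by auto
  qed (use that harmonic in \<open>auto simp: K_def\<close>)
  have lim_norm: "((\<lambda>k. norm (x k)) \<longlongrightarrow> S) F" if "((\<lambda>k. x k - \<phi> k) \<longlongrightarrow> 0) F" for x :: "real^'d \<Rightarrow> complex"
  proof -
    have "((\<lambda>k. norm (x k) - norm (\<phi> k)) \<longlongrightarrow> 0) F"
      using tendsto_norm_zero[OF that]
      by (rule Lim_null_comparison[rotated]) (auto intro!: always_eventually norm_triangle_ineq3)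
    from tendsto_add[OF this F_S] show ?thesis by simp
  qed
  (* Being nearly maximal is preserved by every step. *)
  have F_R: "filterlim (\<lambda>k. k v* R i) F F" if i: "i \<in> I" for i
    unfolding F_def
  proof (subst filterlim_inf, intro conjI)
    have "((\<lambda>k. norm (\<phi> (k v* R i))) \<longlongrightarrow> S) F"
      by (rule Lim_transform_eventually[OF lim_norm[OF lim_z[OF i]]])
         (use F_K in eventually_elim, rule normz[OF i])
    then show "filterlim (\<lambda>k. k v* R i) (filtercomap (\<lambda>k. norm (\<phi> k)) (nhds S))
        (inf (filtercomap (\<lambda>k. norm (\<phi> k)) (nhds S)) (principal K))"
      unfolding filterlim_filtercomap_iff F_def by (simp add: o_def)
    show "filterlim (\<lambda>k. k v* R i) (principal K) (inf (filtercomap (\<lambda>k. norm (\<phi> k)) (nhds S)) (principal K))"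
      unfolding filterlim_principal using F_K KR[OF i] by (auto simp: F_def elim: eventually_mono)
  qed
  have F_monoid: "filterlim (\<lambda>k. k v* C) F F" if "C \<in> matrix_monoid R I" for C
    using that
  proof induction
    case one
    then show ?case by (simp add: filterlim_ident)
  next
    case (step i C)
    from filterlim_compose[OF step.IH F_R[OF step.hyps(1)]] show ?case
      by (simp add: vector_matrix_mul_assoc)
  qed
  define t where "t i j = (mat 1 - R i) *v \<alpha> j - (mat 1 - R j) *v \<alpha> i" for i j
  have lim_t: "((\<lambda>k. cis (2 * pi * (k \<bullet> t i j))) \<longlongrightarrow> 1) F" if ij: "i \<in> I" "j \<in> I" for i j
  proof -
    (* x i j is the contribution of the composition of h i after h j to the Fourier coefficient at k. *)
    define x where "x i j k = cis (2 * pi * (k \<bullet> \<alpha> i)) * z (h j) (k v* R i)" for i j k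
    have lim_x: "((\<lambda>k. x i j k - \<phi> k) \<longlongrightarrow> 0) F" if ij: "i \<in> I" "j \<in> I" for i j
    proof -
      have "((\<lambda>k. z (h j) (k v* R i) - \<phi> (k v* R i)) \<longlongrightarrow> 0) F"
        using filterlim_compose[OF lim_z[OF ij(2)] F_R[OF ij(1)]] .
      then have "((\<lambda>k. cis (2 * pi * (k \<bullet> \<alpha> i)) * (z (h j) (k v* R i) - \<phi> (k v* R i))) \<longlongrightarrow> 0) F"
        by (subst tendsto_norm_zero_iff[symmetric]) (simp add: norm_mult tendsto_norm_zero_iff)
      from tendsto_add[OF this lim_z[OF ij(1)]]
      have lim: "((\<lambda>k. cis (2 * pi * (k \<bullet> \<alpha> i)) * (z (h j) (k v* R i) - \<phi> (k v* R i)) +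
           (z (h i) k - \<phi> k)) \<longlongrightarrow> 0) F" by simp
      show ?thesis
      proof (rule Lim_transform_eventually[OF lim])
        show "\<forall>\<^sub>F k in F. cis (2 * pi * (k \<bullet> \<alpha> i)) * (z (h j) (k v* R i) - \<phi> (k v* R i)) +
           (z (h i) k - \<phi> k) = x i j k - \<phi> k"
          using F_K by eventually_elim (simp add: x_def K_def z[OF ij(1)] algebra_simps)
      qed
    qed
    have x_swap: "x j i k = x i j k * cis (2 * pi * (k \<bullet> t i j))" if k: "k \<in> K" for k
    proof -
      have *: "x i j k = cis (2 * pi * (k \<bullet> (\<alpha> i + R i *v \<alpha> j))) * \<phi> (k v* (R i ** R j))"
        if ij: "i \<in> I" "j \<in> I" for i j
        using KR[OF ij(1) k] z[OF ij(2)]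
        by (simp add: x_def K_def dot_lmul_matrix inner_add_right distrib_left vector_matrix_mul_assoc
              flip: cis_mult)
      have "\<alpha> j + R j *v \<alpha> i = (\<alpha> i + R i *v \<alpha> j) + t i j"
        by (simp add: t_def matrix_vector_mult_diff_rdistrib)
      then have "cis (2 * pi * (k \<bullet> (\<alpha> j + R j *v \<alpha> i))) =
          cis (2 * pi * (k \<bullet> (\<alpha> i + R i *v \<alpha> j))) * cis (2 * pi * (k \<bullet> t i j))"
        by (simp only: inner_add_right distrib_left flip: cis_mult)
      then show ?thesis
        using *[OF ij] *[OF ij(2,1)] comm[OF ij] by simp
    qed
    have "((\<lambda>k. (x j i k - \<phi> k) - (x i j k - \<phi> k)) \<longlongrightarrow> 0 - 0) F"
      by (intro tendsto_diff lim_x ij)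
    then have "((\<lambda>k. norm (x j i k - x i j k) / norm (x i j k)) \<longlongrightarrow> 0 / S) F"
      using S by (intro tendsto_divide lim_norm[OF lim_x[OF ij]] tendsto_norm_zero) simp_all
    moreover have "\<forall>\<^sub>F k in F. norm (x i j k) > 0"
      using order_tendstoD(1)[OF lim_norm[OF lim_x[OF ij]] S] .
    then have "\<forall>\<^sub>F k in F. norm (x j i k - x i j k) / norm (x i j k) = norm (cis (2 * pi * (k \<bullet> t i j)) - 1)"
      using F_K
    proof eventually_elim
      case (elim k)
      have "x j i k - x i j k = x i j k * (cis (2 * pi * (k \<bullet> t i j)) - 1)"
        by (simp add: x_swap[OF elim(2)] algebra_simps)
      then show ?case using elim(1) by (simp add: norm_mult)
    qed
    ultimately have "((\<lambda>k. norm (cis (2 * pi * (k \<bullet> t i j)) - 1)) \<longlongrightarrow> 0 / S) F"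
      by (rule Lim_transform_eventually)
    then show ?thesis
      by (simp add: tendsto_norm_zero_iff LIM_zero_iff)
  qed
  obtain V d where V: "finite V" "V \<subseteq> matrix_monoid R I" "d > 0"
    and rigid: "\<forall>\<xi> b t. (\<forall>m. b m \<in> I) \<and> (\<forall>m. \<xi> (Suc m) = \<xi> m v* R (b m)) \<and>
       (\<forall>m. \<forall>v\<in>V. \<bar>small_part (\<xi> m \<bullet> (v *v t))\<bar> < d) \<longrightarrow> \<xi> 0 \<bullet> t \<in> \<int>"
    using integer_of_small_orbit[of I R, OF I int comm exp] by auto
  have "\<forall>\<^sub>F k in F. \<forall>i\<in>I. \<forall>j\<in>I. \<forall>v\<in>V. \<bar>small_part (k \<bullet> (v *v t i j))\<bar> < d"
  proof (intro eventually_ball_finite I V(1) ballI)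
    fix i j v assume *: "i \<in> I" "j \<in> I" "v \<in> V"
    obtain e where e: "e > 0" "\<And>x. norm (cis (2 * pi * x) - 1) < e \<Longrightarrow> \<bar>small_part x\<bar> < d"
      using small_part_less_if_cis_near_1[OF V(3)] by blast
    have "((\<lambda>k. cis (2 * pi * ((k v* v) \<bullet> t i j))) \<longlongrightarrow> 1) F"
      using * V(2) by (intro filterlim_compose[OF lim_t[OF *(1,2)] F_monoid]) auto
    then have "\<forall>\<^sub>F k in F. dist (cis (2 * pi * ((k v* v) \<bullet> t i j))) 1 < e"
      using e(1) by (rule tendstoD)
    then show "\<forall>\<^sub>F k in F. \<bar>small_part (k \<bullet> (v *v t i j))\<bar> < d"
      by eventually_elim (simp add: e(2) dist_norm dot_lmul_matrix)
  qed
  from evF[OF this] obtain e where e: "e > 0"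
    "\<forall>k\<in>K. norm (\<phi> k) > S - e \<longrightarrow> (\<forall>i\<in>I. \<forall>j\<in>I. \<forall>v\<in>V. \<bar>small_part (k \<bullet> (v *v t i j))\<bar> < d)"
    by auto
  obtain k1 where k1: "k1 \<in> K" "norm (\<phi> k1) > S - e"
    using less_cSUP_iff[of K "\<lambda>k. norm (\<phi> k)" "S - e"] bdd \<open>k0 \<in> K\<close> e(1) unfolding S_def by auto
  (* Some step does not decrease the modulus; iterating it keeps a path nearly maximal for ever. *)
  have ex_next: "\<exists>i\<in>I. norm (\<phi> (k v* R i)) \<ge> norm (\<phi> k)" if k: "k \<in> K" for k
  proof (rule ccontr)
    assume "\<not> ?thesis"
    then have less: "norm (z g k) < norm (\<phi> k)" if "g \<in> h ` I" for g
      using that normz[OF _ k] by auto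
    have "norm (\<phi> k) \<le> (\<Sum>g\<in>h ` I. p g * norm (z g k))"
      using harmonic[of k] k p(2) norm_sum[of "\<lambda>g. p g *\<^sub>R z g k" "h ` I"] by (simp add: K_def less_imp_le)
    also have "\<dots> < (\<Sum>g\<in>h ` I. p g * norm (\<phi> k))"
      using less p I by (intro sum_strict_mono) auto
    also have "\<dots> = norm (\<phi> k)" using p(1) by (simp flip: sum_distrib_right)
    finally show False by simp
  qed
  define nxt where "nxt k = (SOME i. i \<in> I \<and> norm (\<phi> (k v* R i)) \<ge> norm (\<phi> k))" for k
  have nxt: "nxt k \<in> I" "norm (\<phi> (k v* R (nxt k))) \<ge> norm (\<phi> k)" if "k \<in> K" for k
    using someI_ex[of "\<lambda>i. i \<in> I \<and> norm (\<phi> (k v* R i)) \<ge> norm (\<phi> k)"] ex_next[OF that]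
    unfolding nxt_def by blast+
  define \<xi> where "\<xi> = rec_nat k1 (\<lambda>_ k. k v* R (nxt k))"
  have \<xi>: "\<xi> 0 = k1" "\<xi> (Suc m) = \<xi> m v* R (nxt (\<xi> m))" for m
    by (simp_all add: \<xi>_def)
  have path: "\<xi> m \<in> K \<and> norm (\<phi> (\<xi> m)) > S - e" for m
  proof (induction m)
    case (Suc m)
    then show ?case using KR nxt[of "\<xi> m"] by (auto simp: \<xi>(2))
  qed (simp add: \<xi> k1)
  have "k1 \<bullet> t i j \<in> \<int>" if "i \<in> I" "j \<in> I" for i j
    using rigid[rule_format, of "\<lambda>m. nxt (\<xi> m)" \<xi> "t i j"] \<xi> nxt(1) path e(2) that by simp
  then have "k1 = 0"
    using nontrivial[of k1] k1 by (simp add: K_def t_def)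
  then show False using k1 by (simp add: K_def)
qed

section \<open>Fourier coefficients of stationary measures and of Haar measure\<close>

lemma sets_convolution_pmf [simp]: "sets (convolution_pmf \<mu> \<nu>) = sets borel"
  unfolding convolution_pmf_def by (subst sets_measure_of) (simp_all add: sets.sigma_sets_eq[of borel, simplified])

text \<open>
  The convolution is the monadic bind of \<open>\<mu>\<close> with the kernel \<open>g \<mapsto> distr \<nu> borel g\<close>. Outside the
  support this kernel is replaced by \<open>\<nu>\<close>, as the maps there may fail to be measurable.
\<close>
lemma integral_convolution_pmf:
  fixes f :: "'a::topological_space \<Rightarrow> real"
  assumes \<nu>: "prob_space \<nu>" "sets \<nu> = sets borel"
    and \<mu>: "finite (set_pmf \<mu>)" "\<And>g. g \<in> set_pmf \<mu> \<Longrightarrow> g \<in> measurable borel borel"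
    and f: "f \<in> borel_measurable borel" "\<And>x. \<bar>f x\<bar> \<le> B"
  shows "integral\<^sup>L (convolution_pmf \<mu> \<nu>) f = (\<Sum>g\<in>set_pmf \<mu>. pmf \<mu> g * (\<integral>x. f (g x) \<partial>\<nu>))"
proof -
  interpret prob_space \<nu> by fact
  define N where "N g = distr \<nu> borel (if g \<in> set_pmf \<mu> then g else id)" for g
  have meas: "g \<in> measurable \<nu> borel" if "g \<in> set_pmf \<mu>" for g
    using \<mu>(2)[OF that] \<nu>(2) by (simp cong: measurable_cong_sets)
  have meas': "(if g \<in> set_pmf \<mu> then g else id) \<in> measurable \<nu> borel" for g
    using meas[of g] measurable_ident_sets[OF \<nu>(2)] by (auto simp: id_def)
  have probN: "prob_space (N g)" for g
    unfolding N_def by (rule prob_space_distr[OF meas'])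
  have N: "N \<in> measurable (measure_pmf \<mu>) (subprob_algebra borel)"
    using probN by (auto simp: space_subprob_algebra N_def prob_space_imp_subprob_space)
  have eq: "convolution_pmf \<mu> \<nu> = measure_pmf \<mu> \<bind> N"
  proof (rule measure_eqI)
    show "sets (convolution_pmf \<mu> \<nu>) = sets (measure_pmf \<mu> \<bind> N)"
      by (simp add: sets_bind[of _ _ borel] N_def)
    fix A assume "A \<in> sets (convolution_pmf \<mu> \<nu>)"
    then have A: "A \<in> sets borel" by simp
    have "emeasure (measure_pmf \<mu> \<bind> N) A = (\<integral>\<^sup>+g. emeasure (N g) A \<partial>measure_pmf \<mu>)"
      by (rule emeasure_bind[OF _ N A]) simp
    also have "\<dots> = emeasure (convolution_pmf \<mu> \<nu>) A"
      unfolding emeasure_convolution_pmf[OF A]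
      by (rule nn_integral_cong_AE) (auto simp: AE_measure_pmf_iff N_def)
    finally show "emeasure (convolution_pmf \<mu> \<nu>) A = emeasure (measure_pmf \<mu> \<bind> N) A" by simp
  qed
  have "integral\<^sup>L (convolution_pmf \<mu> \<nu>) f = (\<integral>g. integral\<^sup>L (N g) f \<partial>measure_pmf \<mu>)"
    unfolding eq
    by (rule integral_bind[OF f(1) _ N, where B = B and B' = 1])
       (use f(2) probN in \<open>auto intro!: measure_pmf.finite_measure prob_space.emeasure_le_1\<close>)
  also have "\<dots> = (\<Sum>g\<in>set_pmf \<mu>. pmf \<mu> g *\<^sub>R integral\<^sup>L (N g) f)"
    by (rule integral_measure_pmf[OF \<mu>(1)])
  also have "\<dots> = (\<Sum>g\<in>set_pmf \<mu>. pmf \<mu> g * (\<integral>x. f (g x) \<partial>\<nu>))"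
    using meas f(1) by (intro sum.cong) (auto simp: N_def integral_distr)
  finally show ?thesis .
qed

lemma stationary_character:
  fixes \<nu> :: "'d::finite torus measure"
  assumes st: "stationary \<mu> \<nu>" and \<mu>: "finite (set_pmf \<mu>)" "\<And>g. g \<in> set_pmf \<mu> \<Longrightarrow> continuous_on UNIV g"
    and k: "int_vec k"
  shows "integral\<^sup>L \<nu> (character k) = (\<Sum>g\<in>set_pmf \<mu>. pmf \<mu> g *\<^sub>R (\<integral>x. character k (g x) \<partial>\<nu>))"
proof -
  have \<nu>: "prob_space \<nu>" "sets \<nu> = sets borel" and eq: "convolution_pmf \<mu> \<nu> = \<nu>"
    using st by (auto simp: stationary_def)
  have int: "integrable \<nu> (\<lambda>x. character k (g x))" if "continuous_on UNIV g" for g :: "'d torus \<Rightarrow> 'd torus"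
    using continuous_on_compose2[OF continuous_on_character[OF k] that]
    by (intro integrable_continuous_torus[OF \<nu>]) simp
  have meas: "g \<in> borel_measurable borel" if "g \<in> set_pmf \<mu>" for g
    by (rule borel_measurable_continuous_onI[OF \<mu>(2)[OF that]])
  have part: "L (integral\<^sup>L \<nu> (character k)) = L (\<Sum>g\<in>set_pmf \<mu>. pmf \<mu> g *\<^sub>R (\<integral>x. character k (g x) \<partial>\<nu>))"
    if L: "bounded_linear L" "\<And>z. \<bar>L z\<bar> \<le> cmod z" for L :: "complex \<Rightarrow> real"
  proof -
    interpret L: bounded_linear L by fact
    have "(\<lambda>x. L (character k x)) \<in> borel_measurable borel"
      using measurable_compose[OF measurable_character[OF k] borel_measurable_continuous_onI]
        L.continuous_on[OF continuous_on_id] by blast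
    then have "integral\<^sup>L (convolution_pmf \<mu> \<nu>) (\<lambda>x. L (character k x)) =
        (\<Sum>g\<in>set_pmf \<mu>. pmf \<mu> g * (\<integral>x. L (character k (g x)) \<partial>\<nu>))"
      using meas L(2)[of "character k _"] by (intro integral_convolution_pmf[OF \<nu> \<mu>(1), where B = 1]) simp_all
    moreover have "(\<integral>x. L (character k (g x)) \<partial>\<nu>) = L (\<integral>x. character k (g x) \<partial>\<nu>)"
      if "continuous_on UNIV g" for g :: "'d torus \<Rightarrow> 'd torus"
      by (rule integral_bounded_linear[OF L(1) int[OF that]])
    moreover from this[of "\<lambda>x. x"] have "(\<integral>x. L (character k x) \<partial>\<nu>) = L (\<integral>x. character k x \<partial>\<nu>)"
      by simp
    ultimately show ?thesis
      using \<mu>(2) by (simp add: eq L.sum L.scaleR)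
  qed
  show ?thesis
    using part[OF bounded_linear_Re abs_Re_le_cmod] part[OF bounded_linear_Im abs_Im_le_cmod]
    by (simp only: complex_eq_iff)
qed

lemma character_affine_toral:
  assumes "int_vec k"
  shows "character k (affine_toral D \<alpha> t) =
           cis (2 * pi * (k \<bullet> \<alpha>)) * character (k v* map_matrix of_int D) t"
proof -
  obtain x where x: "t = to_torus x" by (rule to_torus_cases)
  have "int_vec (k v* map_matrix of_int D)"
    using assms by (auto simp: int_vec_def vector_matrix_mult_def map_matrix_def intro!: Ints_sum Ints_mult)
  then show ?thesis
    by (simp add: x affine_toral_def toral_endo_to_torus character_to_torus assms dot_lmul_matrix
        inner_add_right distrib_left cis_mult add.commute flip: to_torus_add)
qed

text \<open>
  The image of Haar measure under a surjective endomorphism is invariant under all translations,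
  since a translation by \<open>D y\<close> after the map is a translation by \<open>y\<close> before it.
\<close>
lemma haar_torus_affine_invariant:
  fixes D :: "int^'d::finite^'d"
  assumes "surj ((*v) (map_matrix real_of_int D))"
  shows "distr haar_torus borel (affine_toral D \<alpha>) = haar_torus"
proof -
  have haar: "haar_probability (haar_torus :: 'd torus measure)" by (rule haar_probability_haar_torus)
  then have sets: "sets (haar_torus :: 'd torus measure) = sets borel"
    by (simp add: haar_probability_def)
  interpret prob_space "haar_torus :: 'd torus measure" by (rule prob_space_haar_torus)
  have [measurable]: "affine_toral D \<alpha> \<in> borel_measurable haar_torus"
    using borel_measurable_continuous_onI[OF continuous_on_affine_toral] sets
    by (simp cong: measurable_cong_sets)
  have [measurable]: "(\<lambda>x. a + x) \<in> measurable haar_torus haar_torus" for a :: "'d torus"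
    using borel_measurable_continuous_onI[of "\<lambda>x. a + x"] measurable_cong_sets[OF sets sets]
    by (simp add: continuous_intros)
  have "distr (distr haar_torus borel (affine_toral D \<alpha>)) borel (\<lambda>x. a + x) =
      distr haar_torus borel (affine_toral D \<alpha>)" for a
  proof -
    obtain x where x: "a = to_torus x" by (rule to_torus_cases)
    obtain y where y: "map_matrix real_of_int D *v y = x" using assms by (metis surjD)
    have shift: "a + affine_toral D \<alpha> t = affine_toral D \<alpha> (to_torus y + t)" for t
    proof -
      obtain s where "t = to_torus s" by (rule to_torus_cases)
      then show ?thesis
        by (simp add: x y affine_toral_def toral_endo_to_torus matrix_vector_right_distrib
            flip: to_torus_add) (simp add: to_torus_add add.assoc)
    qed
    have "distr (distr haar_torus borel (affine_toral D \<alpha>)) borel (\<lambda>x. a + x) =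
        distr haar_torus borel (\<lambda>t. a + affine_toral D \<alpha> t)"
      by (subst distr_distr) (auto simp: o_def intro!: borel_measurable_continuous_onI continuous_intros)
    also have "\<dots> = distr (distr haar_torus haar_torus (\<lambda>t. to_torus y + t)) borel (affine_toral D \<alpha>)"
      by (subst distr_distr) (auto simp: o_def shift)
    also have "distr haar_torus haar_torus (\<lambda>t. to_torus y + t) = distr haar_torus borel (\<lambda>t. to_torus y + t)"
      by (rule distr_cong) (auto simp: sets)
    also have "\<dots> = haar_torus" using haar by (simp add: haar_probability_def)
    finally show ?thesis .
  qed
  then have "haar_probability (distr haar_torus borel (affine_toral D \<alpha>))"
    by (auto simp: haar_probability_def intro!: prob_space_distr)
  then show ?thesis by (simp add: haar_probability_iff)
qed

lemma haar_torus_stationary: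
  fixes \<mu> :: "('d::finite torus \<Rightarrow> 'd torus) pmf"
  assumes "\<And>g. g \<in> set_pmf \<mu> \<Longrightarrow> distr haar_torus borel g = haar_torus"
  shows "stationary \<mu> haar_torus"
proof -
  have "convolution_pmf \<mu> haar_torus = (haar_torus :: 'd torus measure)"
  proof (rule measure_eqI)
    show "sets (convolution_pmf \<mu> haar_torus) = sets (haar_torus :: 'd torus measure)"
      by (simp add: haar_torus_def)
    fix A assume "A \<in> sets (convolution_pmf \<mu> haar_torus)"
    then have "emeasure (convolution_pmf \<mu> haar_torus) A = (\<integral>\<^sup>+g. emeasure (distr haar_torus borel g) A \<partial>measure_pmf \<mu>)"
      by (simp add: emeasure_convolution_pmf)
    also have "\<dots> = (\<integral>\<^sup>+g. emeasure haar_torus A \<partial>measure_pmf \<mu>)"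
      by (rule nn_integral_cong_AE) (simp add: AE_measure_pmf_iff assms)
    finally show "emeasure (convolution_pmf \<mu> haar_torus) A = emeasure haar_torus A"
      by (simp add: measure_pmf.emeasure_space_1[simplified])
  qed
  then show ?thesis
    by (simp add: stationary_def prob_space_haar_torus) (simp add: haar_torus_def)
qed

text \<open>
  Translation by a point where the character takes the value \<open>-1\<close> changes the sign of the integral.
\<close>
lemma integral_haar_character:
  assumes k: "int_vec k" "k \<noteq> 0"
  shows "integral\<^sup>L (haar_torus :: 'd::finite torus measure) (character k) = 0"
proof -
  have haar: "haar_probability (haar_torus :: 'd torus measure)" by (rule haar_probability_haar_torus)
  then have sets: "sets (haar_torus :: 'd torus measure) = sets borel"
    and inv: "distr haar_torus borel (\<lambda>x. a + x) = haar_torus" for a :: "'d torus"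
    by (simp_all add: haar_probability_def)
  obtain a where "character k a = -1"
    using ex_character_eq_minus_1[OF k] by blast
  then have shift: "character k (a + t) = - character k t" for t
    by (simp add: character_add[OF k(1)])
  have "(\<lambda>x. a + x) \<in> borel_measurable haar_torus"
    using borel_measurable_continuous_onI[of "\<lambda>x. a + x"] sets
    by (simp add: continuous_intros cong: measurable_cong_sets)
  then have "integral\<^sup>L haar_torus (character k) = (\<integral>t. character k (a + t) \<partial>haar_torus)"
    by (subst (1) inv[of a, symmetric]) (rule integral_distr[OF _ measurable_character[OF k(1)]])
  then show ?thesis by (simp add: shift)
qed

section \<open>Uniqueness of the stationary measure\<close>

lemma expanding_matrix_of_int:
  assumes "expanding D"
  shows "expanding_matrix (map_matrix real_of_int D)"
proof -
  have "map_matrix complex_of_real (map_matrix real_of_int D) = map_matrix of_int D"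
    by (simp add: map_matrix_def vec_eq_iff)
  then show ?thesis
    using assms by (auto simp: expanding_matrix_def expanding_def complex_eigenvalue_def)
qed

lemma map_matrix_of_int_mult:
  "map_matrix real_of_int (A ** B) = map_matrix of_int A ** map_matrix of_int B"
  by (simp add: map_matrix_def matrix_matrix_mult_def vec_eq_iff)

theorem theorem1:
  fixes n :: nat
    and D :: "nat \<Rightarrow> int^'d^'d"
    and \<alpha> :: "nat \<Rightarrow> real^'d"
    and h :: "nat \<Rightarrow> 'd torus \<Rightarrow> 'd torus"
    and \<mu> :: "('d torus \<Rightarrow> 'd torus) pmf"
    and \<nu> :: "'d torus measure"
  assumes commuting: "\<And>i j. i \<in> {1..n} \<Longrightarrow> j \<in> {1..n} \<Longrightarrow> D i ** D j = D j ** D i"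
    and expanding: "\<And>i. i \<in> {1..n} \<Longrightarrow> expanding (D i)"
    and h: "\<And>i. i \<in> {1..n} \<Longrightarrow> h i = affine_toral (D i) (\<alpha> i)"
    and not_contained:
      "\<And>H. closed H \<Longrightarrow> add_subgroup H \<Longrightarrow>
         to_torus ` {(mat 1 - map_matrix of_int (D i)) *v \<alpha> j
                       - (mat 1 - map_matrix of_int (D j)) *v \<alpha> i
                     | i j. i \<in> {1..n} \<and> j \<in> {1..n}} \<subseteq> H \<Longrightarrow>
         H = UNIV"
    and supp: "set_pmf \<mu> = h ` {1..n}"
  shows "stationary \<mu> \<nu> \<longleftrightarrow> \<nu> = haar_torus"
proof
  define R where "R i = map_matrix real_of_int (D i)" for i
  have exp: "expanding_matrix (R i)" if "i \<in> {1..n}" for i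
    using expanding_matrix_of_int[OF expanding[OF that]] by (simp add: R_def)
  show "stationary \<mu> \<nu>" if "\<nu> = haar_torus"
    unfolding that
  proof (rule haar_torus_stationary)
    fix g assume "g \<in> set_pmf \<mu>"
    then obtain i where i: "i \<in> {1..n}" "g = affine_toral (D i) (\<alpha> i)"
      using supp h by auto
    then show "distr haar_torus borel g = haar_torus"
      using haar_torus_affine_invariant surj_expanding_matrix[OF exp[OF i(1)]] by (simp add: R_def)
  qed
  assume st: "stationary \<mu> \<nu>"
  then have \<nu>: "prob_space \<nu>" "sets \<nu> = sets borel" by (auto simp: stationary_def)
  interpret prob_space \<nu> by fact
  have "integral\<^sup>L \<nu> (character k) = 0" if k: "int_vec k" "k \<noteq> 0" for k
  proof (rule twisted_harmonic_vanishes[of "{1..n}" R \<alpha> "pmf \<mu>" h "\<lambda>k. integral\<^sup>L \<nu> (character k)"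
        "\<lambda>g k. \<integral>t. character k (g t) \<partial>\<nu>" 1])
    show "R i $ a $ b \<in> \<int>" for i a b
      by (simp add: R_def map_matrix_def)
    show "R i ** R j = R j ** R i" if "i \<in> {1..n}" "j \<in> {1..n}" for i j
      using commuting[OF that] by (simp add: R_def flip: map_matrix_of_int_mult)
    show "\<xi> = 0" if \<xi>: "int_vec \<xi>"
      and integral: "\<And>i j. i \<in> {1..n} \<Longrightarrow> j \<in> {1..n} \<Longrightarrow>
        \<xi> \<bullet> ((mat 1 - R i) *v \<alpha> j - (mat 1 - R j) *v \<alpha> i) \<in> \<int>" for \<xi>
    proof (rule ccontr)
      assume "\<xi> \<noteq> 0"
      have "{t. character \<xi> t = 1} = UNIV"
        by (rule not_contained[OF closed_kernel_character[OF \<xi>] add_subgroup_kernel_character[OF \<xi>]])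
           (use integral in \<open>auto simp: character_to_torus[OF \<xi>] cis_2pi_eq_1_iff R_def\<close>)
      then show False
        using ex_character_eq_minus_1[OF \<xi> \<open>\<xi> \<noteq> 0\<close>] by (auto simp: set_eq_iff)
    qed
    show "sum (pmf \<mu>) (h ` {1..n}) = 1"
      using supp by (intro sum_pmf_eq_1) auto
    show "pmf \<mu> g > 0" if "g \<in> h ` {1..n}" for g
      using that supp by (simp add: pmf_positive)
    show "integral\<^sup>L \<nu> (character k) =
        (\<Sum>g\<in>h ` {1..n}. pmf \<mu> g *\<^sub>R (\<integral>t. character k (g t) \<partial>\<nu>))" if "int_vec k" for k
      unfolding supp[symmetric]
      by (rule stationary_character[OF st _ _ that]) (auto simp: supp h continuous_on_affine_toral)
    show "(\<integral>t. character k (h i t) \<partial>\<nu>) =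
        cis (2 * pi * (k \<bullet> \<alpha> i)) * integral\<^sup>L \<nu> (character (k v* R i))"
      if "i \<in> {1..n}" "int_vec k" for i k
      using that by (simp add: h character_affine_toral R_def)
    show "norm (integral\<^sup>L \<nu> (character k)) \<le> 1" for k
      using integral_norm_bound[of \<nu> "character k"] by (simp add: prob_space)
  qed (use exp k in auto)
  then show "\<nu> = haar_torus"
  proof (intro torus_measure_eqI[OF \<nu>(1) prob_space_haar_torus \<nu>(2)])
    show "integral\<^sup>L \<nu> (character k) = integral\<^sup>L haar_torus (character k)"
      if "\<And>k. int_vec k \<Longrightarrow> k \<noteq> 0 \<Longrightarrow> integral\<^sup>L \<nu> (character k) = 0" "int_vec k" for k
    proof (cases "k = 0")
      case True
      interpret haar: prob_space "haar_torus :: 'd torus measure"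
        by (rule prob_space_haar_torus)
      show ?thesis using True by (simp add: prob_space haar.prob_space)
    qed (use that integral_haar_character in auto)
  qed (simp_all add: haar_torus_def)
qed

end
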